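(* There is an $O(m|B|)$ time algorithm that, given an unweighted undirected graph $G=(V,E)$ with $m$ edges and $S\subseteq V$ with $T=V\setminus S$, outputs an estimate $D'$ such that $\tfrac{2}{3}D_{ST}(G)-1\leq D'\leq D_{ST}(G)$.
   Context: $d(u,v)$ denotes the shortest path distance in $G$; $D_{ST}(G)=\max_{s\in S}\max_{t\in T}d(s,t)$. Let $S'$ be the set of vertices of $S$ that have a neighbor in $T$, and $T'$ the set of vertices of $T$ that have a neighbor in $S$. The boundary $B$ is whichever of $S'$ and $T'$ is smaller in size. *)

theory Defs
  imports "Graph_Theory.Shortest_Path" "Graph_Theory.Pair_Digraph"
begin

text \<open>
  A finite simple undirected graph is a \<^locale>\<open>pair_graph\<close>: a symmetric, loop-free set of vertex
  pairs. Each undirected edge is therefore represented by two arcs but counted once below.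
\<close>

definition edges :: "'a pair_pre_digraph \<Rightarrow> 'a set set" where
  "edges G = {{u, v} | u v. (u, v) \<in> parcs G}"

definition gdist :: "'a pair_pre_digraph \<Rightarrow> 'a \<Rightarrow> 'a \<Rightarrow> ereal" where
  "gdist G u v = wf_digraph.\<mu> (with_proj G) (\<lambda>_. 1) u v"

text \<open>Only meaningful for finite nonempty \<open>S\<close> and \<open>T\<close>; the value is \<open>\<infinity>\<close> if some vertex of
  \<open>T\<close> is unreachable from some vertex of \<open>S\<close>.\<close>

definition bichromatic_diameter :: "'a pair_pre_digraph \<Rightarrow> 'a set \<Rightarrow> 'a set \<Rightarrow> ereal" where
  "bichromatic_diameter G S T = (MAX s\<in>S. MAX t\<in>T. gdist G s t)"

definition having_nbr_in :: "'a pair_pre_digraph \<Rightarrow> 'a set \<Rightarrow> 'a set \<Rightarrow> 'a set" where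
  "having_nbr_in G A C = {a \<in> A. \<exists>c\<in>C. (a, c) \<in> parcs G}"

definition boundary :: "'a pair_pre_digraph \<Rightarrow> 'a set \<Rightarrow> 'a set \<Rightarrow> 'a set" where
  "boundary G S T =
     (let S' = having_nbr_in G S T; T' = having_nbr_in G T S
      in if card S' \<le> card T' then S' else T')"


text \<open>
  The word RAM. Registers and memory cells hold \<open>w\<close>-bit words, arithmetic is modulo \<open>2 ^ w\<close>, and a
  program is a structured command whose running time charges one unit per evaluated expression node
  and one unit per executed command (sequencing is free). A program mentions finitely many registers
  and does not depend on \<open>w\<close>. Only addition, subtraction and comparison are available, so unit costs
  are not abused by multiplication of large numbers. Addresses are words too, so at most \<open>2 ^ w\<close>
  cells are accessible.
\<close>

datatype exp =
    Const nat
  | Reg string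
  | Mem exp
  | Add exp exp
  | Sub exp exp
  | Less exp exp
  | Eq exp exp

datatype cmd =
    Skip
  | Set_Reg string exp
  | Set_Mem exp exp
  | Seq cmd cmd
  | Cond exp cmd cmd
  | While exp cmd

record ram_state =
  regs :: "string \<Rightarrow> nat"
  mem :: "nat \<Rightarrow> nat"

primrec eval_exp :: "nat \<Rightarrow> exp \<Rightarrow> ram_state \<Rightarrow> nat" where
  "eval_exp w (Const k) s = k mod 2 ^ w"
| "eval_exp w (Reg r) s = regs s r"
| "eval_exp w (Mem a) s = mem s (eval_exp w a s)"
| "eval_exp w (Add a b) s = (eval_exp w a s + eval_exp w b s) mod 2 ^ w"
| "eval_exp w (Sub a b) s = (2 ^ w + eval_exp w a s - eval_exp w b s) mod 2 ^ w"
| "eval_exp w (Less a b) s = of_bool (eval_exp w a s < eval_exp w b s) mod 2 ^ w"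
| "eval_exp w (Eq a b) s = of_bool (eval_exp w a s = eval_exp w b s) mod 2 ^ w"

primrec exp_cost :: "exp \<Rightarrow> nat" where
  "exp_cost (Const k) = 1"
| "exp_cost (Reg r) = 1"
| "exp_cost (Mem a) = 1 + exp_cost a"
| "exp_cost (Add a b) = 1 + exp_cost a + exp_cost b"
| "exp_cost (Sub a b) = 1 + exp_cost a + exp_cost b"
| "exp_cost (Less a b) = 1 + exp_cost a + exp_cost b"
| "exp_cost (Eq a b) = 1 + exp_cost a + exp_cost b"

text \<open>\<open>runs w c s t s'\<close>: with word size \<open>w\<close>, command \<open>c\<close> started in \<open>s\<close> halts in \<open>s'\<close> after exactly
  \<open>t\<close> time units.\<close>

inductive runs :: "nat \<Rightarrow> cmd \<Rightarrow> ram_state \<Rightarrow> nat \<Rightarrow> ram_state \<Rightarrow> bool" for w where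
  Skip: "runs w Skip s 1 s"
| Set_Reg: "runs w (Set_Reg r e) s (1 + exp_cost e)
    (s\<lparr>regs := (regs s)(r := eval_exp w e s)\<rparr>)"
| Set_Mem: "runs w (Set_Mem a e) s (1 + exp_cost a + exp_cost e)
    (s\<lparr>mem := (mem s)(eval_exp w a s := eval_exp w e s)\<rparr>)"
| Seq: "runs w c\<^sub>1 s t\<^sub>1 s' \<Longrightarrow> runs w c\<^sub>2 s' t\<^sub>2 s'' \<Longrightarrow>
    runs w (Seq c\<^sub>1 c\<^sub>2) s (t\<^sub>1 + t\<^sub>2) s''"
| Cond_True: "eval_exp w e s \<noteq> 0 \<Longrightarrow> runs w c\<^sub>1 s t s' \<Longrightarrow>
    runs w (Cond e c\<^sub>1 c\<^sub>2) s (1 + exp_cost e + t) s'"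
| Cond_False: "eval_exp w e s = 0 \<Longrightarrow> runs w c\<^sub>2 s t s' \<Longrightarrow>
    runs w (Cond e c\<^sub>1 c\<^sub>2) s (1 + exp_cost e + t) s'"
| While_False: "eval_exp w e s = 0 \<Longrightarrow>
    runs w (While e c) s (1 + exp_cost e) s"
| While_True: "eval_exp w e s \<noteq> 0 \<Longrightarrow> runs w c s t\<^sub>1 s' \<Longrightarrow> runs w (While e c) s' t\<^sub>2 s'' \<Longrightarrow>
    runs w (While e c) s (1 + exp_cost e + t\<^sub>1 + t\<^sub>2) s''"

inductive_cases runs_SkipE: "runs w Skip s t s'"
inductive_cases runs_Set_RegE: "runs w (Set_Reg r e) s t s'"
inductive_cases runs_Set_MemE: "runs w (Set_Mem a e) s t s'"
inductive_cases runs_SeqE: "runs w (Seq c\<^sub>1 c\<^sub>2) s t s'"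
inductive_cases runs_CondE: "runs w (Cond e c\<^sub>1 c\<^sub>2) s t s'"
inductive_cases runs_WhileE: "runs w (While e c) s t s'"

lemma runs_deterministic:
  "runs w c s t s' \<Longrightarrow> runs w c s u s'' \<Longrightarrow> u = t \<and> s'' = s'"
proof (induction arbitrary: u s'' rule: runs.induct)
  case Skip
  then show ?case by (auto elim: runs_SkipE)
next
  case Set_Reg
  then show ?case by (auto elim: runs_Set_RegE)
next
  case Set_Mem
  then show ?case by (auto elim: runs_Set_MemE)
next
  case Seq
  from Seq.prems show ?case by (rule runs_SeqE) (metis Seq.IH)
next
  case Cond_True
  from Cond_True.prems show ?case
    by (rule runs_CondE) (use Cond_True.hyps(1) in \<open>auto dest: Cond_True.IH\<close>)
next
  case Cond_False
  from Cond_False.prems show ?case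
    by (rule runs_CondE) (use Cond_False.hyps(1) in \<open>auto dest: Cond_False.IH\<close>)
next
  case While_False
  from While_False.prems show ?case
    by (rule runs_WhileE) (use While_False.hyps in auto)
next
  case While_True
  from While_True.prems show ?case
    by (rule runs_WhileE) (use While_True.hyps(1) in \<open>auto dest!: While_True.IH\<close>)
qed

text \<open>
  Input format, for a graph on the vertices \<open>0, \<dots>, n - 1\<close>: the number \<open>n\<close>, the indicator bits
  of \<open>S\<close>, the \<open>n + 1\<close> offsets of the adjacency lists (the last one being the total length), and the
  concatenated adjacency lists. The order within each adjacency list is arbitrary.
\<close>

definition adjacency_lists :: "nat pair_pre_digraph \<Rightarrow> (nat \<Rightarrow> nat list) \<Rightarrow> bool" where
  "adjacency_lists G adj \<longleftrightarrow>
     (\<forall>v\<in>pverts G. distinct (adj v) \<and> set (adj v) = {u. (v, u) \<in> parcs G})"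

definition encode :: "nat \<Rightarrow> nat set \<Rightarrow> (nat \<Rightarrow> nat list) \<Rightarrow> nat list" where
  "encode n S adj =
     n # map (\<lambda>v. of_bool (v \<in> S)) [0..<n]
       @ map (\<lambda>v. \<Sum>u<v. length (adj u)) [0..<Suc n]
       @ concat (map adj [0..<n])"

definition init_state :: "nat list \<Rightarrow> ram_state" where
  "init_state xs = \<lparr>regs = (\<lambda>_. 0), mem = (\<lambda>a. if a < length xs then xs ! a else 0)\<rparr>"

text \<open>The estimate is a natural number or, signalled by a separate flag, \<open>\<infinity>\<close>.\<close>

definition estimate :: "ram_state \<Rightarrow> ereal" where
  "estimate s = (if regs s ''inf'' \<noteq> 0 then \<infinity> else ereal (real (regs s ''out'')))"

end

theory Submission
  imports Defs
begin

text \<open>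
  Let \<open>B\<close> be the smaller boundary and \<open>A\<close> the side containing it. A BFS from every \<open>b \<in> B\<close> yields
  \<open>x\<^sub>C = max d(b,t)\<close> over \<open>t \<notin> A\<close>, \<open>x\<^sub>A = max d(b,s)\<close> over \<open>s \<in> A\<close>, and the largest distances
  \<open>m\<^sub>A\<close>, \<open>m\<^sub>C\<close> of a vertex of \<open>A\<close>, resp. of the other side, to \<open>B\<close>. The estimate is
  \<open>max x\<^sub>C (x\<^sub>A - 1) (m\<^sub>A + m\<^sub>C)\<close>. It is a lower bound because every \<open>b \<in> B\<close> has a neighbour on the
  other side and every path between the sides meets \<open>B\<close>.

  The diameter is infinite iff the graph is disconnected. With fewer than \<open>n\<close> arcs there is an
  isolated vertex, which is detected in constant time; otherwise \<open>n \<le> 2m\<close>, so that each BFS takes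
  time \<open>O(m)\<close>.
\<close>

section \<open>Hop distances\<close>

text \<open>The factor 2/3 comes from averaging. Routing s to t through the boundary vertex nearest
  to s, and again through the one nearest to t, gives two bounds on d(s,t). Their sum is \<open>2 *
  d(s,t) \<le> x\<^sub>A + x\<^sub>C + m\<^sub>A + m\<^sub>C\<close>, and the estimate dominates
  \<open>x\<^sub>C\<close>, \<open>x\<^sub>A - 1\<close> and \<open>m\<^sub>A + m\<^sub>C\<close>.
  Infinity has to be a machine word. The value \<open>n\<close> serves, since no finite distance
  among \<open>n\<close> vertices reaches it. It also marks unvisited vertices and is the minimum
  over an empty boundary, so comparing final registers with \<open>n\<close> detects disconnection.
  Everything outside the searches costs O(n + m), which the product m|B| absorbs only if B is
  nonempty. For empty B the product is 0 and the time bound is a multiple of m + 1 instead.\<close>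

definition hops :: "('a \<times> 'a) set \<Rightarrow> 'a \<Rightarrow> 'a \<Rightarrow> nat" where
  "hops R u v = (LEAST l. (u, v) \<in> R ^^ l)"

lemma relpow_hops: "(u, v) \<in> R\<^sup>* \<Longrightarrow> (u, v) \<in> R ^^ hops R u v"
  unfolding hops_def by (metis LeastI rtrancl_imp_relpow)

lemma hops_le: "(u, v) \<in> R ^^ l \<Longrightarrow> hops R u v \<le> l"
  unfolding hops_def by (rule Least_le)

text \<open>Reachability is assumed because the \<open>LEAST\<close> defining \<open>hops\<close> is
  unspecified when no walk exists.\<close>

lemma hops_triangle:
  assumes "(u, v) \<in> R\<^sup>*" "(v, x) \<in> R\<^sup>*"
  shows "hops R u x \<le> hops R u v + hops R v x"
  using relpow_hops[OF assms(1)] relpow_hops[OF assms(2)]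
  by (intro hops_le) (auto simp: relpow_add)

lemma hops_arc: "(u, v) \<in> R \<Longrightarrow> hops R u v \<le> 1"
  by (rule hops_le) simp

lemma sym_relpow: "sym R \<Longrightarrow> (u, v) \<in> R ^^ l \<Longrightarrow> (v, u) \<in> R ^^ l"
proof (induction l arbitrary: v)
  case (Suc l)
  then obtain y where "(u, y) \<in> R ^^ l" "(y, v) \<in> R" by (meson relpow_Suc_E)
  with Suc show ?case by (meson relpow_Suc_I2 symD)
qed auto

lemma hops_commute: "sym R \<Longrightarrow> hops R u v = hops R v u"
  unfolding hops_def by (metis sym_relpow)

text \<open>Peel off the last arc: if its tail lies in \<open>A\<close>, that tail is the required
  \<open>b\<close> with \<open>j = 1\<close>; otherwise the shorter walk already leaves
  \<open>A\<close>.\<close>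

lemma relpow_crossing:
  assumes "(s, t) \<in> R ^^ l" "s \<in> A" "t \<notin> A"
  shows "\<exists>b i j. b \<in> A \<and> (\<exists>u. u \<notin> A \<and> (b, u) \<in> R) \<and> (s, b) \<in> R ^^ i \<and> (b, t) \<in> R ^^ j \<and> i + j = l"
  using assms
proof (induction l arbitrary: t)
  case 0
  then show ?case by simp
next
  case (Suc l)
  then obtain y where y: "(s, y) \<in> R ^^ l" "(y, t) \<in> R" by (meson relpow_Suc_E)
  show ?case
  proof (cases "y \<in> A")
    case True
    have "(y, t) \<in> R ^^ 1" using y by simp
    with y True Suc.prems(3) show ?thesis by (metis Suc_eq_plus1)
  next
    case False
    from Suc.IH[OF y(1) Suc.prems(2) False] y(2) show ?thesis
      by (metis add_Suc_right relpow_Suc_I)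
  qed
qed

text \<open>A crossing point of a shortest walk reverses the triangle inequality. This is what puts
  the sum of the two distances to the boundary below d(s,t).\<close>

lemma hops_crossing:
  assumes "(s, t) \<in> R\<^sup>*" "s \<in> A" "t \<notin> A"
  obtains b where "b \<in> A" "\<exists>u. u \<notin> A \<and> (b, u) \<in> R" "hops R s b + hops R b t \<le> hops R s t"
  using relpow_crossing[OF relpow_hops[OF assms(1)] assms(2,3)] hops_le
  by (metis add_mono)

text \<open>With \<open>x = d(s, B)\<close> and \<open>y = d(t, B)\<close>, the three terms of the estimate are at least \<open>d(s,t) - x\<close>,
  \<open>d(s,t) - y - 1\<close> and \<open>x + y\<close>; one of them is large enough.\<close>

lemma estimate_ge:
  assumes "(s, t) \<in> R\<^sup>*" "s \<in> A" "t \<notin> A"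
    and B: "B = {b \<in> A. \<exists>u. u \<notin> A \<and> (b, u) \<in> R}"
    and conn: "\<And>b u. b \<in> B \<Longrightarrow> u \<in> {s, t} \<Longrightarrow> (b, u) \<in> R\<^sup>*"
    and "sym R"
    and xA: "\<And>b. b \<in> B \<Longrightarrow> hops R b s \<le> xA" and xC: "\<And>b. b \<in> B \<Longrightarrow> hops R b t \<le> xC"
    and x: "b0 \<in> B" "hops R b0 s \<le> mA" and y: "b1 \<in> B" "hops R b1 t \<le> mC"
  shows "2 * hops R s t \<le> 3 * max (max xC (xA - 1)) (mA + mC) + 3"
proof -
  have c: "(u, b) \<in> R\<^sup>*" if "b \<in> B" "u \<in> {s, t}" for b u
    using conn[OF that] \<open>sym R\<close> by (meson sym_rtrancl symD)
  have "hops R s t \<le> hops R s b0 + hops R b0 t" by (intro hops_triangle c conn x) auto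
  then have 1: "hops R s t \<le> mA + xC"
    using xC[OF x(1)] x(2) hops_commute[OF \<open>sym R\<close>, of s b0] by linarith
  have "hops R s t \<le> hops R s b1 + hops R b1 t" by (intro hops_triangle c conn y) auto
  then have 2: "hops R s t \<le> xA + mC"
    using xA[OF y(1)] y(2) hops_commute[OF \<open>sym R\<close>, of s b1] by linarith
  let ?E = "max (max xC (xA - 1)) (mA + mC)"
  \<comment> \<open>Adding 1 and 2 now yields at most \<open>3 * ?E + 1\<close>. The
    \<open>+ 3\<close> of the conclusion is what a lower bound of the form 2/3 D - 1 becomes after
    clearing denominators.\<close>
  have "xC \<le> ?E" "xA \<le> ?E + 1" "mA + mC \<le> ?E" by auto
  with 1 2 show ?thesis by linarith
qed

section \<open>Comparison with the library's walks, distances and edge sets\<close>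

lemma (in pair_wf_digraph) awalk_relpow:
  "awalk u p v \<Longrightarrow> (u, v) \<in> parcs G ^^ length p"
proof (induction p arbitrary: u)
  case Nil
  then show ?case by (simp add: awalk_Nil_iff)
next
  case (Cons e p)
  then have "(u, snd e) \<in> parcs G" "(snd e, v) \<in> parcs G ^^ length p"
    by (auto simp: awalk_Cons_iff)
  then show ?case by (metis length_Cons relpow_Suc_I2)
qed

lemma (in pair_wf_digraph) relpow_awalk:
  "(u, v) \<in> parcs G ^^ l \<Longrightarrow> u \<in> pverts G \<Longrightarrow> \<exists>p. awalk u p v \<and> length p = l"
proof (induction l arbitrary: u)
  case 0
  then show ?case by (simp add: awalk_Nil_iff)
next
  case (Suc l)
  then obtain y where y: "(u, y) \<in> parcs G" "(y, v) \<in> parcs G ^^ l" by (meson relpow_Suc_E2)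
  with Suc.IH[OF y(2)] in_arcsD2 obtain p where "awalk y p v" "length p = l" by auto
  with y show ?case by (intro exI[of _ "(u, y) # p"]) (auto simp: awalk_Cons_iff)
qed

text \<open>With unit costs the infimum over walks is attained by a walk of minimal length; over the
  empty set of walks it is \<infinity>.\<close>

lemma (in pair_wf_digraph) gdist_eq:
  assumes "u \<in> pverts G"
  shows "gdist G u v = (if (u, v) \<in> (parcs G)\<^sup>* then ereal (hops (parcs G) u v) else \<infinity>)"
proof -
  have cost: "awalk_cost (\<lambda>_. 1) p = real (length p)" for p :: "('a \<times> 'a) list"
    by (induction p) auto
  have eq: "gdist G u v = (INF p\<in>{p. awalk u p v}. ereal (length p))"
    by (simp add: gdist_def \<mu>_def cost)
  show ?thesis
  proof (cases "(u, v) \<in> (parcs G)\<^sup>*")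
    case True
    obtain p where p: "awalk u p v" "length p = hops (parcs G) u v"
      using relpow_awalk[OF relpow_hops[OF True] assms] by blast
    have "(INF p\<in>{p. awalk u p v}. ereal (length p)) = ereal (hops (parcs G) u v)"
    proof (rule antisym)
      show "(INF p\<in>{p. awalk u p v}. ereal (length p)) \<le> ereal (hops (parcs G) u v)"
        using p by (intro INF_lower2[of p]) auto
      show "ereal (hops (parcs G) u v) \<le> (INF p\<in>{p. awalk u p v}. ereal (length p))"
        by (intro INF_greatest) (auto dest!: awalk_relpow hops_le)
    qed
    with True eq show ?thesis by simp
  next
    case False
    then have "{p. awalk u p v} = {}" by (auto dest!: awalk_relpow relpow_imp_rtrancl)
    with False eq show ?thesis by (simp add: top_ereal_def)
  qed
qed

text \<open>Forgetting the direction of an arc is a map onto \<open>edges G\<close> whose fibres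
  have at most two elements.\<close>

lemma (in pair_fin_digraph) card_parcs_le: "card (parcs G) \<le> 2 * card (edges G)"
proof -
  have e: "edges G = (\<lambda>(u, v). {u, v}) ` parcs G" by (auto simp: edges_def)
  have "parcs G \<subseteq> (\<Union>e\<in>edges G. {(u, v). e = {u, v}})" by (auto simp: edges_def)
  moreover have fib: "finite {(u, v). e = {u, v}} \<and> card {(u, v). e = {u, v}} \<le> 2"
    if "e \<in> edges G" for e :: "'a set"
  proof -
    from that obtain a b where "e = {a, b}" by (auto simp: edges_def)
    then have sub: "{(u, v). e = {u, v}} \<subseteq> {(a, b), (b, a)}" by (auto simp: doubleton_eq_iff)
    have "card {(a, b), (b, a)} \<le> 2" by (rule card_insert_le_m1) auto
    with card_mono[OF _ sub] finite_subset[OF sub] show ?thesis by simp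
  qed
  moreover have fe: "finite (edges G)" unfolding e using pair_finite_arcs by simp
  ultimately have "card (parcs G) \<le> card (\<Union>e\<in>edges G. {(u, v). e = {u, v}})"
    by (intro card_mono) auto
  also have "\<dots> \<le> (\<Sum>e\<in>edges G. card {(u, v). e = {u, v}})" by (rule card_UN_le[OF fe])
  also have "\<dots> \<le> (\<Sum>e\<in>edges G. 2)" by (intro sum_mono) (use fib in auto)
  finally show ?thesis by simp
qed

section \<open>Breadth-first search\<close>

text \<open>The cap \<open>n\<close> plays the role of infinity and is what the distance array holds
  for a vertex the search never reaches.\<close>

definition capped_hops :: "nat \<Rightarrow> ('a \<times> 'a) set \<Rightarrow> 'a \<Rightarrow> 'a \<Rightarrow> nat" where
  "capped_hops n R u v = (if (u, v) \<in> R\<^sup>* then hops R u v else n)"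

text \<open>Cut a shortest walk after \<open>i\<close> steps: a shorter route to the cut vertex
  would shorten the whole walk.\<close>

lemma ex_hops_eq:
  assumes "(u, v) \<in> R\<^sup>*" "i \<le> hops R u v"
  shows "\<exists>x. (u, x) \<in> R\<^sup>* \<and> hops R u x = i"
proof -
  obtain k where k: "hops R u v = i + k" using assms(2) le_Suc_ex by blast
  with relpow_hops[OF assms(1)] obtain x where x: "(u, x) \<in> R ^^ i" "(x, v) \<in> R ^^ k"
    by (auto simp: relpow_add)
  then have "(u, x) \<in> R\<^sup>*" "(x, v) \<in> R\<^sup>*" by (simp_all add: relpow_imp_rtrancl)
  from hops_triangle[OF this] hops_le[OF x(1)] hops_le[OF x(2)] k have "hops R u x = i" by linarith
  with \<open>(u, x) \<in> R\<^sup>*\<close> show ?thesis by blast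
qed

text \<open>Pigeonhole: all values from 0 to \<open>hops R u v\<close> occur as distances from
  \<open>u\<close>, hence at that many different vertices of \<open>V\<close>.\<close>

lemma hops_less_card:
  assumes "(u, v) \<in> R\<^sup>*" "R \<subseteq> V \<times> V" "u \<in> V" "finite V"
  shows "hops R u v < card V"
proof -
  have "{..hops R u v} \<subseteq> hops R u ` {x. (u, x) \<in> R\<^sup>*}"
    using ex_hops_eq[OF assms(1)] by blast
  moreover have "{x. (u, x) \<in> R\<^sup>*} \<subseteq> V"
    using assms(2,3) by (auto elim: rtrancl.cases)
  ultimately have "{..hops R u v} \<subseteq> hops R u ` V" by blast
  from card_mono[OF _ this] card_image_le[of V "hops R u"] assms(4) show ?thesis by force
qed

lemma capped_hops_le:
  assumes "R \<subseteq> {..<n} \<times> {..<n}" "u < n"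
  shows "capped_hops n R u v \<le> n" "capped_hops n R u v < n \<longleftrightarrow> (u, v) \<in> R\<^sup>*"
  using hops_less_card[of u v R "{..<n}"] assms by (auto simp: capped_hops_def less_imp_le)

text \<open>State of a breadth-first search from \<open>b\<close>: \<open>d v = n\<close> marks an unvisited vertex, the queue is
  \<open>Q 0, \<dots>, Q (l - 1)\<close>, its first \<open>h\<close> entries are fully processed, and \<open>X\<close> is the set of
  neighbours of \<open>Q h\<close> inspected so far.\<close>

locale bfs_inv =
  fixes n :: nat and R :: "(nat \<times> nat) set" and b :: nat and d Q :: "nat \<Rightarrow> nat"
    and h l :: nat and X :: "nat set"
  assumes inj: "inj_on Q {..<l}"
    and visited: "Q ` {..<l} = {v. v < n \<and> d v \<noteq> n}"
    and source: "b < n" "d b = 0"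
    and head: "h \<le> l"
    and walk: "\<And>i. i < l \<Longrightarrow> (b, Q i) \<in> R ^^ d (Q i)"
    and small: "\<And>i. i < l \<Longrightarrow> d (Q i) \<le> i"
    and sorted: "\<And>i j. i \<le> j \<Longrightarrow> j < l \<Longrightarrow> d (Q i) \<le> d (Q j)"
    and two_layers: "\<And>i. h < l \<Longrightarrow> i < l \<Longrightarrow> d (Q i) \<le> Suc (d (Q h))"
    and processed: "\<And>i u. i < h \<Longrightarrow> (Q i, u) \<in> R \<Longrightarrow> d u \<noteq> n \<and> d u \<le> Suc (d (Q i))"
    and inspected: "\<And>u. u \<in> X \<Longrightarrow> d u \<noteq> n \<and> d u \<le> Suc (d (Q h))"
begin

lemma queue_vertex: "i < l \<Longrightarrow> Q i < n" and queue_visited: "i < l \<Longrightarrow> d (Q i) \<noteq> n"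
  using visited by auto

lemma visitedE:
  assumes "v < n" "d v \<noteq> n"
  obtains i where "i < l" "v = Q i"
  using assms visited by blast

lemma length_le: "l \<le> n"
  using card_inj_on_le[OF inj, of "{..<n}"] visited by auto

text \<open>By \<open>small\<close>, the new label satisfies
  \<open>Suc (d (Q h)) \<le> l < n\<close>, so it cannot be confused with the mark \<open>n\<close>.
  By \<open>two_layers\<close>, no queued label exceeds it, so appending keeps the queue
  sorted.\<close>

lemma visit:
  assumes "h < l" "(Q h, y) \<in> R" "y < n" "d y = n"
  shows "bfs_inv n R b (d(y := Suc (d (Q h)))) (Q(l := y)) h (Suc l) (insert y X)" "l < n"
proof -
  let ?d = "d(y := Suc (d (Q h)))" and ?Q = "Q(l := y)"
  have new: "Q i \<noteq> y" if "i < l" for i using queue_visited[OF that] assms(4) by auto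
  have im: "?Q ` {..<Suc l} = insert y (Q ` {..<l})" by (auto simp: lessThan_Suc)
  have inj': "inj_on ?Q {..<Suc l}"
    using inj new unfolding inj_on_def by (fastforce simp: less_Suc_eq)
  have "?Q ` {..<Suc l} \<subseteq> {..<n}" using im visited assms(3) by auto
  from card_inj_on_le[OF inj' this] show "l < n" by simp
  have dh: "d (Q h) < l" using small[OF assms(1)] assms(1) by simp
  have old: "?Q i = Q i" "?d (Q i) = d (Q i)" if "i < l" for i using that new[OF that] by auto
  have last: "?Q l = y" "?d y = Suc (d (Q h))" by auto
  note upd = fun_upd_apply[simp del]
  show "bfs_inv n R b ?d ?Q h (Suc l) (insert y X)"
  proof
    show "inj_on ?Q {..<Suc l}" by (rule inj')
    show "?Q ` {..<Suc l} = {v. v < n \<and> ?d v \<noteq> n}"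
      unfolding im visited using assms(3) dh \<open>l < n\<close> by (auto simp: fun_upd_apply)
    have "b \<noteq> y" using source assms(4) dh \<open>l < n\<close> by auto
    then show "b < n" "?d b = 0" "h \<le> Suc l" using source head by (auto simp: fun_upd_apply)
    have walk': "(b, y) \<in> R ^^ Suc (d (Q h))" by (rule relpow_Suc_I[OF walk[OF assms(1)] assms(2)])
    show "(b, ?Q i) \<in> R ^^ ?d (?Q i)" if "i < Suc l" for i
    proof (cases "i = l")
      case True
      with walk' last show ?thesis by (simp del: relpow.simps)
    next
      case False
      with that old walk show ?thesis by simp
    qed
    show "?d (?Q i) \<le> i" if "i < Suc l" for i
      using that old small last dh by (cases "i = l") auto
    show "?d (?Q i) \<le> ?d (?Q j)" if ij: "i \<le> j" "j < Suc l" for i j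
    proof (cases "j = l")
      case True
      then have "?d (?Q j) = Suc (d (Q h))" using last by simp
      then show ?thesis using ij True old last two_layers[OF assms(1), of i] by (cases "i = l") auto
    next
      case False
      then show ?thesis using ij old sorted[of i j] by simp
    qed
    show "?d (?Q i) \<le> Suc (?d (?Q h))" if "h < Suc l" "i < Suc l" for i
      using that old last two_layers assms(1) by (cases "i = l") auto
    show "?d u \<noteq> n \<and> ?d u \<le> Suc (?d (?Q i))" if iu: "i < h" "(?Q i, u) \<in> R" for i u
    proof -
      have "i < l" using iu assms(1) by simp
      then have "d u \<noteq> n \<and> d u \<le> Suc (d (Q i))" using processed[of i u] iu old by simp
      with assms(4) old[OF \<open>i < l\<close>] show ?thesis by (auto simp: fun_upd_apply)
    qed
    show "?d u \<noteq> n \<and> ?d u \<le> Suc (?d (?Q h))" if "u \<in> insert y X" for u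
      using that inspected[of u] old[OF assms(1)] dh \<open>l < n\<close> by (auto simp: fun_upd_apply)
  qed
qed

text \<open>A visited vertex is already in the queue, so \<open>two_layers\<close> supplies the
  bound that \<open>inspected\<close> demands.\<close>

lemma skip:
  assumes "h < l" "y < n" "d y \<noteq> n"
  shows "bfs_inv n R b d Q h l (insert y X)"
proof -
  have "d y \<le> Suc (d (Q h))" using visitedE[OF assms(2,3)] two_layers[OF assms(1)] by metis
  then show ?thesis
    by unfold_locales
      (use inj visited source head walk small sorted two_layers processed inspected assms(3) in blast)+
qed

text \<open>\<open>inspected\<close> becomes the clause of \<open>processed\<close> for index
  \<open>h\<close>, and by \<open>sorted\<close> the label of the head does not decrease, which
  preserves \<open>two_layers\<close>.\<close>

lemma dequeue:
  assumes "h < l" "R `` {Q h} \<subseteq> X"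
  shows "bfs_inv n R b d Q (Suc h) l {}"
proof
  show "d (Q i) \<le> Suc (d (Q (Suc h)))" if "Suc h < l" "i < l" for i
    using two_layers[OF assms(1) that(2)] sorted[of h "Suc h"] that(1) by simp
  show "d u \<noteq> n \<and> d u \<le> Suc (d (Q i))" if "i < Suc h" "(Q i, u) \<in> R" for i u
    using that processed[of i u] inspected[of u] assms(2) by (cases "i = h") auto
qed (use inj visited source head walk small sorted assms(1) in auto)

text \<open>With the queue exhausted, \<open>processed\<close> says that visited vertices are closed
  under arcs and labels grow by at most one per arc, so labels are at most the distances;
  \<open>walk\<close> gives the converse.\<close>

lemma final:
  assumes "h = l" and R: "R \<subseteq> {..<n} \<times> {..<n}" and "u < n"
  shows "d u = capped_hops n R b u"
proof -
  have upper: "d v \<noteq> n \<and> d v \<le> k \<and> v < n" if "(b, v) \<in> R ^^ k" for v k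
    using that
  proof (induction k arbitrary: v)
    case 0
    then show ?case using source by auto
  next
    case (Suc k)
    then obtain y where y: "(b, y) \<in> R ^^ k" "(y, v) \<in> R" by (meson relpow_Suc_E)
    from Suc.IH[OF y(1)] have dy: "d y \<noteq> n" "d y \<le> k" "y < n" by auto
    then obtain i where "i < l" "y = Q i" using visitedE by blast
    then have "d v \<noteq> n \<and> d v \<le> Suc (d y)" using processed y(2) assms(1) by blast
    with dy R y(2) show ?case by auto
  qed
  show ?thesis
  proof (cases "d u = n")
    case True
    then have "(b, u) \<notin> R\<^sup>*" using upper by (metis relpow_hops)
    with True show ?thesis by (simp add: capped_hops_def)
  next
    case False
    then have walk: "(b, u) \<in> R ^^ d u" using visitedE[OF \<open>u < n\<close>] walk by metis
    then have "(b, u) \<in> R\<^sup>*" by (rule relpow_imp_rtrancl)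
    with hops_le[OF walk] upper[OF relpow_hops[OF this]] show ?thesis
      by (simp add: capped_hops_def)
  qed
qed

end

lemma bfs_inv_init:
  assumes "b < n" "\<And>v. v < n \<Longrightarrow> d v = (if v = b then 0 else n)" "Q 0 = b"
  shows "bfs_inv n R b d Q 0 1 {}"
proof
  show "inj_on Q {..<1}" by (simp add: inj_on_def)
  show "Q ` {..<1} = {v. v < n \<and> d v \<noteq> n}"
    unfolding lessThan_Suc One_nat_def
  proof (intro set_eqI iffI)
    fix v assume "v \<in> {v. v < n \<and> d v \<noteq> n}"
    then show "v \<in> Q ` insert 0 {..<0}" using assms(2)[of v] assms(3) by (auto split: if_splits)
  qed (use assms(1,3) assms(2)[OF assms(1)] in auto)
qed (use assms in auto)

section \<open>Weakest preconditions for the word RAM\<close>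

text \<open>Total correctness with a running clock: \<open>t\<close> is the time before the command
  and \<open>Q\<close> receives the time after it, so time bounds can be stated inside loop
  invariants.\<close>

definition wp :: "nat \<Rightarrow> cmd \<Rightarrow> (ram_state \<Rightarrow> nat \<Rightarrow> bool) \<Rightarrow> ram_state \<Rightarrow> nat \<Rightarrow> bool" where
  "wp w c Q s t \<longleftrightarrow> (\<exists>t' s'. runs w c s t' s' \<and> Q s' (t + t'))"

lemma runs_Skip_iff: "runs w Skip s t s' \<longleftrightarrow> t = 1 \<and> s' = s"
  by (metis runs_SkipE runs.Skip)

lemma runs_Set_Reg_iff: "runs w (Set_Reg r e) s t s' \<longleftrightarrow>
    t = 1 + exp_cost e \<and> s' = s\<lparr>regs := (regs s)(r := eval_exp w e s)\<rparr>"
  using runs.Set_Reg[of w r e s] by (auto elim: runs_Set_RegE)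

lemma runs_Set_Mem_iff: "runs w (Set_Mem a e) s t s' \<longleftrightarrow>
    t = 1 + exp_cost a + exp_cost e \<and> s' = s\<lparr>mem := (mem s)(eval_exp w a s := eval_exp w e s)\<rparr>"
  using runs.Set_Mem[of w a e s] by (auto elim: runs_Set_MemE)

lemma runs_Seq_iff: "runs w (Seq c d) s t s' \<longleftrightarrow>
    (\<exists>t1 s1 t2. runs w c s t1 s1 \<and> runs w d s1 t2 s' \<and> t = t1 + t2)"
  by (blast elim: runs_SeqE intro: runs.Seq)

lemma runs_Cond_iff: "runs w (Cond e c d) s t s' \<longleftrightarrow>
    (\<exists>u. t = 1 + exp_cost e + u \<and> runs w (if eval_exp w e s \<noteq> 0 then c else d) s u s')"
  (is "_ \<longleftrightarrow> ?R")
proof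
  assume "runs w (Cond e c d) s t s'"
  then show ?R by (rule runs_CondE) auto
next
  assume ?R
  then show "runs w (Cond e c d) s t s'"
    by (cases "eval_exp w e s = 0") (metis runs.Cond_False, metis runs.Cond_True)
qed

lemma wp_Skip [simp]: "wp w Skip Q s t = Q s (t + 1)"
  by (simp add: wp_def runs_Skip_iff)

lemma wp_Set_Reg [simp]:
  "wp w (Set_Reg r e) Q s t = Q (s\<lparr>regs := (regs s)(r := eval_exp w e s)\<rparr>) (t + (1 + exp_cost e))"
  by (simp add: wp_def runs_Set_Reg_iff)

lemma wp_Set_Mem [simp]:
  "wp w (Set_Mem a e) Q s t =
    Q (s\<lparr>mem := (mem s)(eval_exp w a s := eval_exp w e s)\<rparr>) (t + (1 + exp_cost a + exp_cost e))"
  by (simp add: wp_def runs_Set_Mem_iff)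

lemma wp_Seq [simp]: "wp w (Seq c d) Q s t = wp w c (wp w d Q) s t"
proof -
  have "wp w (Seq c d) Q s t \<longleftrightarrow>
      (\<exists>t1 s1 t2 s2. runs w c s t1 s1 \<and> runs w d s1 t2 s2 \<and> Q s2 (t + (t1 + t2)))"
    unfolding wp_def runs_Seq_iff by blast
  then show ?thesis unfolding wp_def add.assoc by blast
qed

lemma wp_Cond [simp]:
  "wp w (Cond e c d) Q s t =
    (if eval_exp w e s \<noteq> 0 then wp w c Q s (t + (1 + exp_cost e)) else wp w d Q s (t + (1 + exp_cost e)))"
proof -
  have "wp w (Cond e c d) Q s t \<longleftrightarrow> wp w (if eval_exp w e s \<noteq> 0 then c else d) Q s (t + (1 + exp_cost e))"
    unfolding wp_def runs_Cond_iff add.assoc[of t] by blast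
  then show ?thesis by simp
qed

lemma wp_mono: "wp w c Q s t \<Longrightarrow> (\<And>s t. Q s t \<Longrightarrow> Q' s t) \<Longrightarrow> wp w c Q' s t"
  unfolding wp_def by blast

definition incr :: "string \<Rightarrow> ram_state \<Rightarrow> ram_state" where
  "incr r s = s\<lparr>regs := (regs s)(r := Suc (regs s r))\<rparr>"

definition for_to :: "string \<Rightarrow> exp \<Rightarrow> cmd \<Rightarrow> cmd" where
  "for_to r e c = While (Less (Reg r) e) (Seq c (Set_Reg r (Add (Reg r) (Const 1))))"

text \<open>Induction on the iterations left. A test costs \<open>3 + exp_cost e\<close> and the
  increment 4. The bound is re-evaluated in every round, so \<open>bound\<close> asks that the
  invariant fix its value; \<open>b < 2 ^ w\<close> keeps the counter from wrapping.\<close>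

lemma wp_for_to:
  assumes init: "I a s t" "regs s r = a" "a \<le> b" "b < 2 ^ w"
    and bound: "\<And>i s t. I i s t \<Longrightarrow> regs s r = i \<Longrightarrow> i \<le> b \<Longrightarrow> eval_exp w e s = b"
    and step: "\<And>i s t. I i s t \<Longrightarrow> regs s r = i \<Longrightarrow> a \<le> i \<Longrightarrow> i < b \<Longrightarrow>
        wp w c (\<lambda>s' t'. regs s' r = i \<and> I (Suc i) (incr r s') (t' + 4)) s (t + (3 + exp_cost e))"
    and exit: "\<And>s t. I b s t \<Longrightarrow> regs s r = b \<Longrightarrow> Q s (t + (3 + exp_cost e))"
  shows "wp w (for_to r e c) Q s t"
proof -
  have "wp w (for_to r e c) Q s t" if "I i s t" "regs s r = i" "a \<le> i" "i \<le> b" for i s t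
    using that
  proof (induction "b - i" arbitrary: i s t)
    case 0
    from 0 have "i = b" by simp
    with 0 bound have "eval_exp w (Less (Reg r) e) s = 0" by auto
    from runs.While_False[OF this, of "Seq c (Set_Reg r (Add (Reg r) (Const 1)))"] exit[of s t] 0 \<open>i = b\<close>
    show ?case unfolding wp_def for_to_def
      by (intro exI[of _ "1 + exp_cost (Less (Reg r) e)"] exI[of _ s]) (simp add: ac_simps eval_nat_numeral)
  next
    case (Suc k)
    then have "i < b" by simp
    with init(4) have "w \<noteq> 0" by (intro notI) simp
    with init(4) \<open>i < b\<close> have w: "1 mod 2 ^ w = (1::nat)" "Suc i mod 2 ^ w = Suc i" by auto
    from bound[of i s t] Suc \<open>i < b\<close> w have tru: "eval_exp w (Less (Reg r) e) s \<noteq> 0" by auto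
    from step[OF Suc.prems(1-3) \<open>i < b\<close>] obtain t1 s1 where
      1: "runs w c s t1 s1" "regs s1 r = i" "I (Suc i) (incr r s1) (t + (3 + exp_cost e) + t1 + 4)"
      unfolding wp_def by blast
    have 2: "runs w (Set_Reg r (Add (Reg r) (Const 1))) s1 4 (incr r s1)"
      using runs.Set_Reg[of w r "Add (Reg r) (Const 1)" s1] 1(2) w by (simp add: incr_def eval_nat_numeral)
    have "wp w (for_to r e c) Q (incr r s1) (t + (3 + exp_cost e) + t1 + 4)"
      using Suc 1 \<open>i < b\<close> by (intro Suc.hyps(1)[of "Suc i"]) (auto simp: incr_def)
    then obtain t2 s2 where 3: "runs w (for_to r e c) (incr r s1) t2 s2"
      "Q s2 (t + (3 + exp_cost e) + t1 + 4 + t2)" unfolding wp_def by blast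
    from runs.While_True[OF tru runs.Seq[OF 1(1) 2] 3(1)[unfolded for_to_def]] 3(2)
    show ?case unfolding wp_def for_to_def
      by (intro exI[of _ "1 + exp_cost (Less (Reg r) e) + (t1 + 4) + t2"] exI[of _ s2]) (simp add: ac_simps)
  qed
  then show ?thesis using init by blast
qed

definition max_into :: "string \<Rightarrow> exp \<Rightarrow> cmd" where
  "max_into r e = Cond (Less (Reg r) e) (Set_Reg r e) Skip"

text \<open>The time is that of the assigning branch, which evaluates \<open>e\<close> twice. For
  \<open>w = 0\<close> the truth value 1 would be reduced to 0.\<close>

lemma wp_max_into:
  assumes "0 < w"
    and "\<And>t'. t' \<le> t + (4 + 2 * exp_cost e) \<Longrightarrow>
      Q (s\<lparr>regs := (regs s)(r := max (regs s r) (eval_exp w e s))\<rparr>) t'"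
  shows "wp w (max_into r e) Q s t"
proof -
  have "1 mod 2 ^ w = (1::nat)" using assms(1) by (cases w) auto
  then show ?thesis using assms(2) by (auto simp: max_into_def max_def fun_upd_idem not_less)
qed

section \<open>The program\<close>

text \<open>Symbolic execution must leave the literal \<open>Const 1\<close> in programs alone, or the loop rule no longer matches.\<close>

declare One_nat_def [simp del] Suc_eq_plus1 [symmetric, simp] plus_1_eq_Suc [simp]

text \<open>Addresses follow \<open>encode\<close>: cell 0 holds \<open>n\<close>, the side bits
  start at 1, the offsets at \<open>n + 1\<close>, the adjacency lists at \<open>2 * n + 2\<close>.
  As \<open>Start size_exp\<close> is the total length of the lists, \<open>arrays_exp\<close>
  evaluates to the first free cell.\<close>

definition size_exp :: exp where "size_exp = Mem (Const 0)"
definition Side :: "exp \<Rightarrow> exp" where "Side x = Mem (Add (Const 1) x)"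
definition Start :: "exp \<Rightarrow> exp" where "Start x = Mem (Add (Add size_exp (Const 1)) x)"
definition Tgt :: "exp \<Rightarrow> exp" where "Tgt x = Mem (Add (Add (Const 2) (Add size_exp size_exp)) x)"
definition arrays_exp :: exp where "arrays_exp = Add (Add (Const 2) (Add size_exp size_exp)) (Start size_exp)"
definition DistA :: "exp \<Rightarrow> exp" where "DistA x = Add arrays_exp x"
definition QueueA :: "exp \<Rightarrow> exp" where "QueueA x = Add (Add arrays_exp size_exp) x"
definition NearA :: "exp \<Rightarrow> exp" where "NearA x = Add (Add arrays_exp (Add size_exp size_exp)) x"
definition Dist :: "exp \<Rightarrow> exp" where "Dist x = Mem (DistA x)"
definition Queue :: "exp \<Rightarrow> exp" where "Queue x = Mem (QueueA x)"
definition Near :: "exp \<Rightarrow> exp" where "Near x = Mem (NearA x)"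

lemma exp_costs [simp]:
  "exp_cost size_exp = 2" "exp_cost (Side x) = exp_cost x + 3" "exp_cost (Start x) = exp_cost x + 6"
  "exp_cost (Tgt x) = exp_cost x + 9" "exp_cost (DistA x) = exp_cost x + 17"
  "exp_cost (QueueA x) = exp_cost x + 20" "exp_cost (NearA x) = exp_cost x + 23"
  "exp_cost (Dist x) = exp_cost x + 18" "exp_cost (Queue x) = exp_cost x + 21"
  "exp_cost (Near x) = exp_cost x + 24"
  by (simp_all add: size_exp_def Side_def Start_def Tgt_def arrays_exp_def DistA_def QueueA_def NearA_def
      Dist_def Queue_def Near_def)

text \<open>
  Registers: \<open>v\<close> is the vertex of the main loop, \<open>j\<close> a position in the adjacency lists, \<open>f\<close> whether
  \<open>v\<close> is on the boundary of its side, \<open>g\<close> the indicator of the side whose boundary is smaller, \<open>h\<close>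
  and \<open>l\<close> the ends of the queue. The farthest vertices from the boundary on its own and on the other
  side are tracked in \<open>a\<close> and \<open>b\<close>; \<open>p\<close> and \<open>q\<close> hold the two boundary sizes first, and at the end the
  largest distances to the boundary on the two sides. Behind the input, of length \<open>L\<close>, memory holds
  three arrays of length \<open>n\<close>: BFS distances, BFS queue, and distances to the boundary.
\<close>

definition boundary_test_cmd :: cmd where
  "boundary_test_cmd = Seq (Set_Reg ''f'' (Const 0)) (Seq (Set_Reg ''j'' (Start (Reg ''v'')))
    (for_to ''j'' (Start (Add (Reg ''v'') (Const 1)))
      (Cond (Eq (Side (Tgt (Reg ''j''))) (Side (Reg ''v''))) Skip (Set_Reg ''f'' (Const 1)))))"

text \<open>Conjunctions are arithmetic: \<open>1 < f + side\<close> means boundary vertex in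
  \<open>S\<close>, and \<open>side < f\<close> boundary vertex outside \<open>S\<close>. The same
  pass fills both distance arrays with \<open>n\<close>.\<close>

definition count_cmd :: cmd where
  "count_cmd = for_to ''v'' size_exp (Seq boundary_test_cmd
    (Seq (Set_Reg ''p'' (Add (Reg ''p'') (Less (Const 1) (Add (Reg ''f'') (Side (Reg ''v''))))))
    (Seq (Set_Reg ''q'' (Add (Reg ''q'') (Less (Side (Reg ''v'')) (Reg ''f''))))
    (Seq (Set_Mem (DistA (Reg ''v'')) size_exp) (Set_Mem (NearA (Reg ''v'')) size_exp)))))"

definition expand_cmd :: cmd where
  "expand_cmd = Seq (Set_Reg ''x'' (Queue (Reg ''h''))) (Seq (Set_Reg ''j'' (Start (Reg ''x'')))
    (for_to ''j'' (Start (Add (Reg ''x'') (Const 1)))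
      (Seq (Set_Reg ''y'' (Tgt (Reg ''j'')))
        (Cond (Eq (Dist (Reg ''y'')) size_exp)
          (Seq (Set_Mem (DistA (Reg ''y'')) (Add (Dist (Reg ''x'')) (Const 1)))
          (Seq (Set_Mem (QueueA (Reg ''l'')) (Reg ''y''))
               (Set_Reg ''l'' (Add (Reg ''l'') (Const 1)))))
          Skip))))"

text \<open>The loop always makes \<open>n\<close> rounds and idles once the queue is empty, so the
  counting-loop rule applies at an extra cost of O(n).\<close>

definition bfs_cmd :: cmd where
  "bfs_cmd = Seq (Set_Mem (DistA (Reg ''v'')) (Const 0)) (Seq (Set_Mem (QueueA (Const 0)) (Reg ''v''))
    (Seq (Set_Reg ''l'' (Const 1)) (Seq (Set_Reg ''h'' (Const 0))
      (for_to ''h'' size_exp (Cond (Less (Reg ''h'') (Reg ''l'')) expand_cmd Skip)))))"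

text \<open>Besides collecting results, the pass resets the distance array to \<open>n\<close>, as
  the next search expects.\<close>

definition update_cmd :: cmd where
  "update_cmd = Seq (Set_Reg ''u'' (Const 0)) (for_to ''u'' size_exp
    (Seq (Cond (Less (Dist (Reg ''u'')) (Near (Reg ''u'')))
           (Set_Mem (NearA (Reg ''u'')) (Dist (Reg ''u''))) Skip)
    (Seq (Cond (Eq (Side (Reg ''u'')) (Reg ''g''))
           (max_into ''a'' (Dist (Reg ''u''))) (max_into ''b'' (Dist (Reg ''u''))))
      (Set_Mem (DistA (Reg ''u'')) size_exp))))"

definition main_cmd :: cmd where
  "main_cmd = Seq (Set_Reg ''v'' (Const 0)) (for_to ''v'' size_exp (Seq boundary_test_cmd
    (Cond (Less (Const 1) (Add (Reg ''f'') (Eq (Side (Reg ''v'')) (Reg ''g''))))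
      (Seq bfs_cmd update_cmd) Skip)))"

definition gap_cmd :: cmd where
  "gap_cmd = Seq (Set_Reg ''u'' (Const 0)) (Seq (Set_Reg ''p'' (Const 0)) (Seq (Set_Reg ''q'' (Const 0))
    (for_to ''u'' size_exp (Cond (Eq (Side (Reg ''u'')) (Reg ''g''))
      (max_into ''p'' (Near (Reg ''u''))) (max_into ''q'' (Near (Reg ''u'')))))))"

text \<open>Testing \<open>p\<close> catches an empty boundary, for which \<open>a\<close> and
  \<open>b\<close> stay 0. The guard on \<open>a\<close> prevents 0 - 1 from wrapping to the largest
  word.\<close>

definition out_cmd :: cmd where
  "out_cmd = Seq (Set_Reg ''inf'' (Add (Eq (Reg ''a'') size_exp) (Add (Eq (Reg ''b'') size_exp) (Eq (Reg ''p'') size_exp))))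
    (Seq (Set_Reg ''out'' (Add (Reg ''p'') (Reg ''q''))) (Seq (max_into ''out'' (Reg ''b''))
      (Cond (Reg ''a'') (max_into ''out'' (Sub (Reg ''a'') (Const 1))) Skip)))"

text \<open>\<open>Start size_exp\<close> is the number of arcs, so the first test is the
  constant-time detection of an isolated vertex.\<close>

definition program :: cmd where
  "program = Cond (Less (Start size_exp) size_exp) (Set_Reg ''inf'' (Const 1))
    (Seq count_cmd (Seq (Set_Reg ''g'' (Eq (Const 0) (Less (Reg ''q'') (Reg ''p''))))
      (Seq main_cmd (Seq gap_cmd out_cmd))))"

section \<open>Memory layout and evaluation of address expressions\<close>

locale encoded_graph =
  fixes w n :: nat and R :: "(nat \<times> nat) set" and S :: "nat set" and deg tgt inp off :: "nat \<Rightarrow> nat"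
  assumes off_eq: "\<And>v. off v = (\<Sum>u<v. deg u)"
    and arcs_subset: "R \<subseteq> {..<n} \<times> {..<n}"
    and arcs_from: "\<And>v. v < n \<Longrightarrow> tgt ` {off v..<off v + deg v} = R `` {v}"
    and inp_n: "inp 0 = n"
    and inp_side: "\<And>v. v < n \<Longrightarrow> inp (Suc v) = of_bool (v \<in> S)"
    and inp_off: "\<And>v. v \<le> n \<Longrightarrow> inp (n + 1 + v) = off v"
    and inp_tgt: "\<And>j. j < off n \<Longrightarrow> inp (2 + 2 * n + j) = tgt j"
    and word_size: "8 * (2 + 2 * n + off n) \<le> 2 ^ w"
begin

definition L :: nat where "L = 2 + 2 * n + off n"

definition input :: "(nat \<Rightarrow> nat) \<Rightarrow> bool" where
  "input m \<longleftrightarrow> (\<forall>a<L. m a = inp a)"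
text \<open>The default 0 outside the range lets each array ignore writes to other cells, so the
  update rules below are equations between functions.\<close>

definition dist_arr :: "(nat \<Rightarrow> nat) \<Rightarrow> nat \<Rightarrow> nat" where
  "dist_arr m v = (if v < n then m (L + v) else 0)"
definition queue_arr :: "(nat \<Rightarrow> nat) \<Rightarrow> nat \<Rightarrow> nat" where
  "queue_arr m i = (if i < n then m (L + n + i) else 0)"
definition near_arr :: "(nat \<Rightarrow> nat) \<Rightarrow> nat \<Rightarrow> nat" where
  "near_arr m v = (if v < n then m (L + 2 * n + v) else 0)"

lemma mem_update [simp]:
  assumes "v < n"
  shows "input (m(L + v := x)) = input m"
    "input (m(L + n + v := x)) = input m" "input (m(L + 2 * n + v := x)) = input m"
    "dist_arr (m(L + v := x)) = (dist_arr m)(v := x)"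
    "dist_arr (m(L + n + v := x)) = dist_arr m" "dist_arr (m(L + 2 * n + v := x)) = dist_arr m"
    "queue_arr (m(L + v := x)) = queue_arr m"
    "queue_arr (m(L + n + v := x)) = (queue_arr m)(v := x)" "queue_arr (m(L + 2 * n + v := x)) = queue_arr m"
    "near_arr (m(L + v := x)) = near_arr m"
    "near_arr (m(L + n + v := x)) = near_arr m" "near_arr (m(L + 2 * n + v := x)) = (near_arr m)(v := x)"
  using assms by (auto simp: input_def dist_arr_def queue_arr_def near_arr_def fun_eq_iff)

lemma off_Suc [simp]: "off (Suc v) = off v + deg v"
  by (simp add: off_eq)

lemma off_mono: "u \<le> v \<Longrightarrow> off u \<le> off v"
  unfolding off_eq by (intro sum_mono2) auto

lemma off_add_deg_le: "v < n \<Longrightarrow> off v + deg v \<le> off n"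
  using off_mono[of "Suc v" n] by simp

lemma w_pos [simp]: "0 < w"
  using word_size by (cases w) (auto simp: L_def)

text \<open>The factor 8 is generous: array addresses stay below \<open>L + 3 * n\<close>, and sums
  of two distances below \<open>L\<close>.\<close>

lemma mod_word [simp]: "x < 8 * (2 + 2 * n + off n) \<Longrightarrow> x mod 2 ^ w = x"
  using word_size by (simp add: L_def)

lemma less_word: "x < 8 * (2 + 2 * n + off n) \<Longrightarrow> x < 2 ^ w"
  using word_size by (simp add: L_def)

lemma of_bool_mod [simp]: "of_bool P mod 2 ^ w = (of_bool P :: nat)"
  by (cases P) auto

context
  fixes s :: ram_state
  assumes input: "input (mem s)"
begin

lemma eval_size_exp [simp]: "eval_exp w size_exp s = n"
  using input inp_n by (simp add: size_exp_def input_def L_def)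

lemma eval_Side [simp]:
  "eval_exp w x s < n \<Longrightarrow> eval_exp w (Side x) s = of_bool (eval_exp w x s \<in> S)"
  using input inp_side by (simp add: Side_def input_def L_def plus_1_eq_Suc)

lemma eval_Start [simp]: "eval_exp w x s \<le> n \<Longrightarrow> eval_exp w (Start x) s = off (eval_exp w x s)"
  using input inp_off[of "eval_exp w x s"] by (simp add: Start_def input_def L_def)

lemma eval_Tgt [simp]: "eval_exp w x s < off n \<Longrightarrow> eval_exp w (Tgt x) s = tgt (eval_exp w x s)"
  using input inp_tgt[of "eval_exp w x s"] by (simp add: Tgt_def input_def L_def mult_2)

lemma eval_arrays_exp: "eval_exp w arrays_exp s = L"
  by (simp add: arrays_exp_def L_def mult_2)

lemma eval_addresses [simp]:
  assumes "eval_exp w x s < n"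
  shows "eval_exp w (DistA x) s = L + eval_exp w x s"
    "eval_exp w (QueueA x) s = L + n + eval_exp w x s"
    "eval_exp w (NearA x) s = L + 2 * n + eval_exp w x s"
  using assms by (simp_all add: DistA_def QueueA_def NearA_def eval_arrays_exp) (simp_all add: L_def)

lemma eval_arrays [simp]:
  assumes "eval_exp w x s < n"
  shows "eval_exp w (Dist x) s = dist_arr (mem s) (eval_exp w x s)"
    "eval_exp w (Queue x) s = queue_arr (mem s) (eval_exp w x s)"
    "eval_exp w (Near x) s = near_arr (mem s) (eval_exp w x s)"
  using assms by (simp_all add: Dist_def Queue_def Near_def dist_arr_def queue_arr_def near_arr_def)

end

lemma tgt_arc:
  assumes "v < n" "off v \<le> j" "j < off v + deg v"
  shows "(v, tgt j) \<in> R" "tgt j < n" "j < off n"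
proof -
  show "(v, tgt j) \<in> R" using arcs_from[OF assms(1)] assms(2,3) by auto
  then show "tgt j < n" using arcs_subset by auto
  show "j < off n" using off_add_deg_le[OF assms(1)] assms(3) by simp
qed

section \<open>Detecting and counting boundary vertices\<close>

definition on_boundary :: "nat \<Rightarrow> bool" where
  "on_boundary v \<longleftrightarrow> (\<exists>u. (v, u) \<in> R \<and> (u \<in> S) \<noteq> (v \<in> S))"

text \<open>The final state is given exactly, which spares the callers frame conditions.\<close>

lemma wp_boundary_test:
  assumes "input (mem s)" "regs s ''v'' = v" "v < n"
    and "\<And>t'. t' \<le> t + 60 * deg v + 60 \<Longrightarrow>
      Q (s\<lparr>regs := (regs s)(''f'' := of_bool (on_boundary v), ''j'' := off v + deg v)\<rparr>) t'"
  shows "wp w boundary_test_cmd Q s t"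
proof -
  define F where "F i = s\<lparr>regs := (regs s)(''f'' :=
    of_bool (\<exists>j\<in>{off v..<i}. (tgt j \<in> S) \<noteq> (v \<in> S)), ''j'' := i)\<rparr>" for i
  have on_boundary: "(\<exists>j\<in>{off v..<off v + deg v}. (tgt j \<in> S) \<noteq> (v \<in> S)) \<longleftrightarrow> on_boundary v"
    using arcs_from[OF assms(3)] unfolding on_boundary_def by (metis (no_types, lifting) Image_singleton_iff imageE image_eqI)
  have F: "mem (F i) = mem s" "regs (F i) ''v'' = v" "regs (F i) ''j'' = i" for i
    using assms(2) by (simp_all add: F_def)
  have le: "off v + deg v \<le> off n" using assms(3) by (rule off_add_deg_le)
  show ?thesis
    unfolding boundary_test_cmd_def
  proof (simp add: assms(1-3) less_imp_le, rule wp_for_to[where a = "off v" and b = "off v + deg v"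
        and I = "\<lambda>i s' t'. s' = F i \<and> t' \<le> t + 20 + 60 * (i - off v)"], goal_cases)
    case (6 i s' t')
    then have I: "s' = F i" "t' \<le> t + 20 + 60 * (i - off v)" and i: "off v \<le> i" "i < off v + deg v"
      by auto
    have j: "tgt i < n" "i < off n" using tgt_arc[OF assms(3) i] by auto
    have set: "{off v..<Suc i} = insert i {off v..<i}" using i by auto
    have inc: "incr ''j'' (F i\<lparr>regs := (regs (F i))(''f'' := 1)\<rparr>) = F (Suc i)" if "(tgt i \<in> S) \<noteq> (v \<in> S)"
      using that by (simp add: incr_def F_def set fun_upd_twist)
    have inc': "incr ''j'' (F i) = F (Suc i)" if "(tgt i \<in> S) = (v \<in> S)"
      using that by (simp add: incr_def F_def set fun_upd_twist)
    show ?case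
      using I j i assms(1,3) F inc inc' by (auto simp: Suc_diff_le)
  next
    case 1
    then show ?case by (simp add: F_def)
  next
    case (5 i s' t')
    then show ?case using F assms by auto
  next
    case (7 s' t')
    then show ?case using F assms on_boundary by (auto simp: F_def)
  qed (use less_word le in auto)
qed

text \<open>The scan of vertex \<open>i\<close> costs O(deg i); the term \<open>60 * off i\<close>
  of the invariant sums these costs to the number of arcs.\<close>

lemma wp_count:
  assumes "input (mem s)" "regs s ''v'' = 0" "regs s ''p'' = 0" "regs s ''q'' = 0"
    and Q: "\<And>s' t'. input (mem s') \<Longrightarrow> \<forall>u<n. dist_arr (mem s') u = n \<and> near_arr (mem s') u = n \<Longrightarrow>
      regs s' ''p'' = card {u. u < n \<and> on_boundary u \<and> u \<in> S} \<Longrightarrow>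
      regs s' ''q'' = card {u. u < n \<and> on_boundary u \<and> u \<notin> S} \<Longrightarrow>
      \<forall>r. r \<notin> {''v'', ''f'', ''j'', ''p'', ''q''} \<longrightarrow> regs s' r = regs s r \<Longrightarrow>
      t' \<le> t + 60 * off n + 200 * n + 10 \<Longrightarrow> Q s' t'"
  shows "wp w count_cmd Q s t"
  unfolding count_cmd_def
proof (rule wp_for_to[where a = 0 and b = n and I = "\<lambda>i s' t'. input (mem s') \<and>
      (\<forall>u<i. dist_arr (mem s') u = n \<and> near_arr (mem s') u = n) \<and>
      regs s' ''p'' = card {u. u < i \<and> on_boundary u \<and> u \<in> S} \<and>
      regs s' ''q'' = card {u. u < i \<and> on_boundary u \<and> u \<notin> S} \<and>
      (\<forall>r. r \<notin> {''v'', ''f'', ''j'', ''p'', ''q''} \<longrightarrow> regs s' r = regs s r) \<and>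
      t' \<le> t + 60 * off i + 200 * i"], goal_cases)
  case (6 i s' t')
  have card: "card {u. u < Suc i \<and> P u} = card {u. u < i \<and> P u} + of_bool (P i)" for P
  proof -
    have "{u. u < Suc i \<and> P u} = (if P i then insert i {u. u < i \<and> P u} else {u. u < i \<and> P u})"
      by (auto simp: less_Suc_eq)
    then show ?thesis by simp
  qed
  have le: "card {u. u < i \<and> P u} \<le> i" for P
    using card_mono[of "{..<i}" "{u. u < i \<and> P u}"] by auto
  note le = le[of "\<lambda>u. on_boundary u \<and> u \<in> S"] le[of "\<lambda>u. on_boundary u \<and> u \<notin> S"]
  note card = card[of "\<lambda>u. on_boundary u \<and> u \<in> S"] card[of "\<lambda>u. on_boundary u \<and> u \<notin> S"]
  show ?case
    unfolding wp_Seq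
  proof (rule wp_boundary_test[where v = i], goal_cases)
    case (4 t'')
    have pq: "of_bool (1 < of_bool (on_boundary i) + (of_bool (i \<in> S) :: nat)) = (of_bool (on_boundary i \<and> i \<in> S) :: nat)"
      "of_bool (of_bool (i \<in> S) < (of_bool (on_boundary i) :: nat)) = (of_bool (on_boundary i \<and> i \<notin> S) :: nat)"
      "of_bool (P::bool) \<le> (1 :: nat)" for P
      by auto
    from 6 4 le show ?case
      by (simp add: incr_def card All_less_Suc pq) blast
  qed (use 6 in auto)
next
  case (7 s' t')
  then show ?case by (intro Q) auto
qed (use assms less_word off_eq in auto)

section \<open>Execution of one breadth-first search\<close>

lemma wp_expand:
  assumes input: "input (mem s)" and h: "regs s ''h'' = h" "h < regs s ''l''" and b: "b < n"
    and inv: "bfs_inv n R b (dist_arr (mem s)) (queue_arr (mem s)) h (regs s ''l'') {}"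
    and Q: "\<And>s' t'. input (mem s') \<Longrightarrow> near_arr (mem s') = near_arr (mem s) \<Longrightarrow> h < regs s' ''l'' \<Longrightarrow>
      bfs_inv n R b (dist_arr (mem s')) (queue_arr (mem s')) (Suc h) (regs s' ''l'') {} \<Longrightarrow>
      \<forall>k\<le>h. queue_arr (mem s') k = queue_arr (mem s) k \<Longrightarrow>
      \<forall>r. r \<notin> {''x'', ''j'', ''y'', ''l''} \<longrightarrow> regs s' r = regs s r \<Longrightarrow>
      t' \<le> t + 150 * deg (queue_arr (mem s) h) + 150 \<Longrightarrow> Q s' t'"
  shows "wp w expand_cmd Q s t"
proof -
  define x where "x = queue_arr (mem s) h"
  have xn: "x < n" "h < n"
    using bfs_inv.queue_vertex[OF inv h(2)] bfs_inv.length_le[OF inv] h(2) unfolding x_def by auto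
  have le: "off x + deg x \<le> off n" using xn(1) by (rule off_add_deg_le)
  have ev: "eval_exp w (Queue (Reg ''h'')) s = x" using input h xn unfolding x_def by simp
  show ?thesis
    unfolding expand_cmd_def
  proof (simp add: ev input xn less_imp_le, rule wp_for_to[where a = "off x" and b = "off x + deg x" and I = "\<lambda>i s' t'. input (mem s') \<and>
      near_arr (mem s') = near_arr (mem s) \<and> h < regs s' ''l'' \<and> regs s' ''x'' = x \<and>
      bfs_inv n R b (dist_arr (mem s')) (queue_arr (mem s')) h (regs s' ''l'') (tgt ` {off x..<i}) \<and>
      (\<forall>k\<le>h. queue_arr (mem s') k = queue_arr (mem s) k) \<and>
      (\<forall>r. r \<notin> {''x'', ''j'', ''y'', ''l''} \<longrightarrow> regs s' r = regs s r) \<and>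
      t' \<le> t + 60 + 150 * (i - off x)"], goal_cases)
    case (6 i s' t')
    then have I: "input (mem s')" "near_arr (mem s') = near_arr (mem s)" "h < regs s' ''l''" "regs s' ''x'' = x"
      "bfs_inv n R b (dist_arr (mem s')) (queue_arr (mem s')) h (regs s' ''l'') (tgt ` {off x..<i})"
      "\<forall>k\<le>h. queue_arr (mem s') k = queue_arr (mem s) k"
      "\<forall>r. r \<notin> {''x'', ''j'', ''y'', ''l''} \<longrightarrow> regs s' r = regs s r"
      "t' \<le> t + 60 + 150 * (i - off x)" "regs s' ''j'' = i" and i: "off x \<le> i" "i < off x + deg x"
      by auto
    interpret bfs_inv n R b "dist_arr (mem s')" "queue_arr (mem s')" h "regs s' ''l''" "tgt ` {off x..<i}"
      by (rule I)
    have qx: "queue_arr (mem s') h = x" using I(6) x_def by simp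
    have j: "(x, tgt i) \<in> R" "tgt i < n" "i < off n" using tgt_arc[OF xn(1) i] by auto
    have set: "tgt ` {off x..<Suc i} = insert (tgt i) (tgt ` {off x..<i})"
      using i by (auto simp: atLeastLessThanSuc)
    have dx: "dist_arr (mem s') x < n" using small[OF I(3)] qx xn(2) by simp
    show ?case
    proof (cases "dist_arr (mem s') (tgt i) = n")
      case True
      from visit[OF I(3) _ j(2) True] j(1) qx have
        v: "bfs_inv n R b ((dist_arr (mem s'))(tgt i := Suc (dist_arr (mem s') x)))
          ((queue_arr (mem s'))(regs s' ''l'' := tgt i)) h (Suc (regs s' ''l'')) (tgt ` {off x..<Suc i})"
        and l: "regs s' ''l'' < n" unfolding set by auto
      from I(1-4,6-9) i j True v l xn dx show ?thesis by (simp add: incr_def Suc_diff_le)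
    next
      case False
      from skip[OF I(3) j(2) False] I(1-4,6-9) i j False show ?thesis
        by (simp add: incr_def Suc_diff_le set)
    qed
  next
    case (7 s' t')
    then interpret bfs_inv n R b "dist_arr (mem s')" "queue_arr (mem s')" h "regs s' ''l''" "tgt ` {off x..<off x + deg x}"
      by simp
    have "queue_arr (mem s') h = x" using 7 x_def by simp
    then have "bfs_inv n R b (dist_arr (mem s')) (queue_arr (mem s')) (Suc h) (regs s' ''l'') {}"
      using 7 arcs_from[OF xn(1)] by (intro dequeue) auto
    with 7 show ?case by (intro Q) (auto simp: x_def)
  qed (use assms xn le less_word ev in auto)
qed

text \<open>Using \<open>min i l\<close> as head covers idle rounds. The time is charged to degrees
  of dequeued vertices; these are distinct by \<open>inj\<close>, so the degrees add up to at most
  \<open>off n\<close>. This sum is why \<open>wp_expand\<close> guarantees that queue entries up to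
  \<open>h\<close> are unchanged.\<close>

lemma wp_bfs:
  assumes input: "input (mem s)" and v: "regs s ''v'' = v" "v < n"
    and fresh: "\<forall>u<n. dist_arr (mem s) u = n"
    and Q: "\<And>s' t'. input (mem s') \<Longrightarrow> near_arr (mem s') = near_arr (mem s) \<Longrightarrow>
      \<forall>u<n. dist_arr (mem s') u = capped_hops n R v u \<Longrightarrow>
      \<forall>r. r \<notin> {''h'', ''l'', ''x'', ''j'', ''y''} \<longrightarrow> regs s' r = regs s r \<Longrightarrow>
      t' \<le> t + 150 * off n + 200 * n + 200 \<Longrightarrow> Q s' t'"
  shows "wp w bfs_cmd Q s t"
proof -
  have n: "0 < n" using v by simp
  \<comment> \<open>Simplification rewrites the address \<open>L + n + 0\<close> of the first queue
    cell to \<open>L + n\<close>, so the update rules are needed in that form.\<close>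
  note upd0 = mem_update[OF n, simplified]
  have ev: "eval_exp w (QueueA (Const 0)) s' = L + n" if "input (mem s')" for s'
    using eval_addresses(2)[OF that, of "Const 0"] n by simp
  let ?d = "(dist_arr (mem s))(v := 0)" and ?q = "(queue_arr (mem s))(0 := v)"
  have init: "bfs_inv n R v ?d ?q 0 1 {}"
    using fresh v by (intro bfs_inv_init) auto
  show ?thesis
    unfolding bfs_cmd_def
  proof (simp add: input v ev upd0, rule wp_for_to[where a = 0 and b = n and I = "\<lambda>i s' t'.
      input (mem s') \<and> near_arr (mem s') = near_arr (mem s) \<and>
      bfs_inv n R v (dist_arr (mem s')) (queue_arr (mem s')) (min i (regs s' ''l'')) (regs s' ''l'') {} \<and>
      (\<forall>r. r \<notin> {''h'', ''l'', ''x'', ''j'', ''y''} \<longrightarrow> regs s' r = regs s r) \<and>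
      t' \<le> t + 100 + 200 * i + 150 * (\<Sum>k<min i (regs s' ''l''). deg (queue_arr (mem s') k))"], goal_cases)
    case 1
    from init show ?case using input v by (simp add: upd0)
  next
    case (6 i s' t')
    then have I: "input (mem s')" "near_arr (mem s') = near_arr (mem s)"
      "bfs_inv n R v (dist_arr (mem s')) (queue_arr (mem s')) (min i (regs s' ''l'')) (regs s' ''l'') {}"
      "\<forall>r. r \<notin> {''h'', ''l'', ''x'', ''j'', ''y''} \<longrightarrow> regs s' r = regs s r"
      "t' \<le> t + 100 + 200 * i + 150 * (\<Sum>k<min i (regs s' ''l''). deg (queue_arr (mem s') k))"
      "regs s' ''h'' = i" "i < n"
      by blast+
    show ?case
    proof (cases "i < regs s' ''l''")
      case True
      then have min: "min i (regs s' ''l'') = i" by simp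
      have "wp w expand_cmd (\<lambda>(s''::ram_state) t''. regs s'' ''h'' = i \<and> input (mem (incr ''h'' s'')) \<and>
        near_arr (mem (incr ''h'' s'')) = near_arr (mem s) \<and>
        bfs_inv n R v (dist_arr (mem (incr ''h'' s''))) (queue_arr (mem (incr ''h'' s'')))
          (min (Suc i) (regs (incr ''h'' s'') ''l'')) (regs (incr ''h'' s'') ''l'') {} \<and>
        (\<forall>r. r \<notin> {''h'', ''l'', ''x'', ''j'', ''y''} \<longrightarrow> regs (incr ''h'' s'') r = regs s r) \<and>
        t'' + 4 \<le> t + 100 + 200 * Suc i +
          150 * (\<Sum>k<min (Suc i) (regs (incr ''h'' s'') ''l''). deg (queue_arr (mem (incr ''h'' s'')) k)))
        s' (9 + t')"
      proof (rule wp_expand[OF I(1,6) True v(2) I(3)[unfolded min]])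
        fix s'' :: ram_state and t''
        assume E: "input (mem s'')" "near_arr (mem s'') = near_arr (mem s')" "i < regs s'' ''l''"
          "bfs_inv n R v (dist_arr (mem s'')) (queue_arr (mem s'')) (Suc i) (regs s'' ''l'') {}"
          "\<forall>k\<le>i. queue_arr (mem s'') k = queue_arr (mem s') k"
          "\<forall>r. r \<notin> {''x'', ''j'', ''y'', ''l''} \<longrightarrow> regs s'' r = regs s' r"
          "t'' \<le> 9 + t' + 150 * deg (queue_arr (mem s') i) + 150"
        have m: "mem (incr ''h'' s'') = mem s''" "regs (incr ''h'' s'') ''l'' = regs s'' ''l''"
          "min (Suc i) (regs s'' ''l'') = Suc i" "regs s'' ''h'' = i"
          using E(3,6) I(6) by (auto simp: incr_def)
        have "(\<Sum>k<i. deg (queue_arr (mem s'') k)) = (\<Sum>k<i. deg (queue_arr (mem s') k))"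
          using E(5) by (intro sum.cong) auto
        moreover have "queue_arr (mem s'') i = queue_arr (mem s') i" using E(5) by simp
        ultimately have "t'' + 4 \<le> t + 100 + 200 * Suc i + 150 * (\<Sum>k<Suc i. deg (queue_arr (mem s'') k))"
          using E(7) I(5) unfolding min by simp
        moreover have "\<forall>r. r \<notin> {''h'', ''l'', ''x'', ''j'', ''y''} \<longrightarrow> regs (incr ''h'' s'') r = regs s r"
          using E(6) I(4) by (simp add: incr_def)
        ultimately show "regs s'' ''h'' = i \<and> input (mem (incr ''h'' s'')) \<and>
          near_arr (mem (incr ''h'' s'')) = near_arr (mem s) \<and>
          bfs_inv n R v (dist_arr (mem (incr ''h'' s''))) (queue_arr (mem (incr ''h'' s'')))
            (min (Suc i) (regs (incr ''h'' s'') ''l'')) (regs (incr ''h'' s'') ''l'') {} \<and>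
          (\<forall>r. r \<notin> {''h'', ''l'', ''x'', ''j'', ''y''} \<longrightarrow> regs (incr ''h'' s'') r = regs s r) \<and>
          t'' + 4 \<le> t + 100 + 200 * Suc i +
            150 * (\<Sum>k<min (Suc i) (regs (incr ''h'' s'') ''l''). deg (queue_arr (mem (incr ''h'' s'')) k))"
          unfolding m using E(1,2,4) I(2) by simp
      qed
      with I(6) True show ?thesis by simp
    next
      case False
      then have "min i (regs s' ''l'') = regs s' ''l''" "min (Suc i) (regs s' ''l'') = regs s' ''l''"
        by simp_all
      with I False show ?thesis by (simp add: incr_def)
    qed
  next
    case (7 s' t')
    then have I: "bfs_inv n R v (dist_arr (mem s')) (queue_arr (mem s')) (min n (regs s' ''l'')) (regs s' ''l'') {}"
      by simp
    interpret bfs_inv n R v "dist_arr (mem s')" "queue_arr (mem s')" "min n (regs s' ''l'')" "regs s' ''l''" "{}"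
      by (rule I)
    have l: "min n (regs s' ''l'') = regs s' ''l''" using length_le by simp
    have "(\<Sum>k<regs s' ''l''. deg (queue_arr (mem s') k)) = sum deg (queue_arr (mem s') ` {..<regs s' ''l''})"
      using inj by (simp add: sum.reindex)
    also have "\<dots> \<le> off n"
      unfolding off_eq[of n] using queue_vertex by (intro sum_mono2) auto
    finally show ?case
      using 7 l final[OF l arcs_subset] by (intro Q) auto
  qed (use assms less_word in auto)
qed

section \<open>Accumulating eccentricities and distances to the boundary\<close>

text \<open>The extra 0 matches the initial register value and makes the empty set harmless.\<close>

definition max0 :: "('a \<Rightarrow> nat) \<Rightarrow> 'a set \<Rightarrow> nat" where
  "max0 f X = Max (insert 0 (f ` X))"

lemma max0_empty [simp]: "max0 f {} = 0"
  by (simp add: max0_def)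

lemma max0_insert [simp]: "finite X \<Longrightarrow> max0 f (insert x X) = max (f x) (max0 f X)"
  by (simp add: max0_def insert_commute[of 0])

text \<open>\<open>g\<close> selects the side, \<open>True\<close> for \<open>S\<close>; the bound
  \<open>i\<close> gives the prefix needed in loop invariants.\<close>

abbreviation half :: "bool \<Rightarrow> nat \<Rightarrow> nat set" where
  "half g i \<equiv> {u. u < i \<and> (u \<in> S \<longleftrightarrow> g)}"

lemma half_Suc: "half g (Suc i) = (if i \<in> S \<longleftrightarrow> g then insert i (half g i) else half g i)"
  by (auto simp: less_Suc_eq)

lemma wp_update:
  assumes input: "input (mem s)" and D: "\<forall>u<n. dist_arr (mem s) u = D u"
    and g: "regs s ''g'' = of_bool g"
    and Q: "\<And>s' t'. input (mem s') \<Longrightarrow> \<forall>u<n. dist_arr (mem s') u = n \<Longrightarrow>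
      \<forall>u<n. near_arr (mem s') u = min (near_arr (mem s) u) (D u) \<Longrightarrow>
      regs s' ''a'' = max (regs s ''a'') (max0 D (half g n)) \<Longrightarrow>
      regs s' ''b'' = max (regs s ''b'') (max0 D (half (\<not> g) n)) \<Longrightarrow>
      \<forall>r. r \<notin> {''u'', ''a'', ''b''} \<longrightarrow> regs s' r = regs s r \<Longrightarrow>
      t' \<le> t + 250 * n + 10 \<Longrightarrow> Q s' t'"
  shows "wp w update_cmd Q s t"
  unfolding update_cmd_def
proof (simp add: input, rule wp_for_to[where a = 0 and b = n and I = "\<lambda>i s' t'. input (mem s') \<and>
      (\<forall>u<n. dist_arr (mem s') u = (if u < i then n else D u)) \<and>
      (\<forall>u<n. near_arr (mem s') u = (if u < i then min (near_arr (mem s) u) (D u) else near_arr (mem s) u)) \<and>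
      regs s' ''a'' = max (regs s ''a'') (max0 D (half g i)) \<and>
      regs s' ''b'' = max (regs s ''b'') (max0 D (half (\<not> g) i)) \<and>
      (\<forall>r. r \<notin> {''u'', ''a'', ''b''} \<longrightarrow> regs s' r = regs s r) \<and>
      t' \<le> t + 5 + 250 * i"], goal_cases)
  case (6 i s' t')
  then have I: "input (mem s')" "\<forall>u<n. dist_arr (mem s') u = (if u < i then n else D u)"
    "\<forall>u<n. near_arr (mem s') u = (if u < i then min (near_arr (mem s) u) (D u) else near_arr (mem s) u)"
    "regs s' ''a'' = max (regs s ''a'') (max0 D (half g i)) \<and>
      regs s' ''b'' = max (regs s ''b'') (max0 D (half (\<not> g) i))"
    "\<forall>r. r \<notin> {''u'', ''a'', ''b''} \<longrightarrow> regs s' r = regs s r"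
    "t' \<le> t + 5 + 250 * i" "regs s' ''u'' = i" "i < n"
    by blast+
  \<comment> \<open>The memory after the conditional write, common to both branches, so the rest of
    the body is verified once.\<close>
  define m where "m = (if D i < near_arr (mem s) i then (mem s')(L + 2 * n + i := D i) else mem s')"
  have m: "input m" "dist_arr m = dist_arr (mem s')"
    "near_arr m = (near_arr (mem s'))(i := min (near_arr (mem s) i) (D i))"
    using I by (auto simp: m_def min_def fun_eq_iff)
  have nr: "\<forall>u<n. near_arr m u = (if u < Suc i then min (near_arr (mem s) u) (D u) else near_arr (mem s) u)"
    unfolding m using I(3) by (simp add: less_Suc_eq)
  have ds: "\<forall>u<n. ((dist_arr m)(i := n)) u = (if u < Suc i then n else D u)"
    unfolding m using I(2) by (simp add: less_Suc_eq)
  have Di: "dist_arr (mem s') i = D i" using I(2,8) by simp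
  have fin: "finite (half g i)" for g by simp
  let ?Q = "\<lambda>(s''::ram_state) t''. regs s'' ''u'' = i \<and> input (mem s'') \<and>
      (\<forall>u<n. dist_arr (mem s'') u = (if u < Suc i then n else D u)) \<and>
      (\<forall>u<n. near_arr (mem s'') u = (if u < Suc i then min (near_arr (mem s) u) (D u) else near_arr (mem s) u)) \<and>
      regs s'' ''a'' = max (regs s ''a'') (max0 D (half g (Suc i))) \<and>
      regs s'' ''b'' = max (regs s ''b'') (max0 D (half (\<not> g) (Suc i))) \<and>
      (\<forall>r. r \<notin> {''u'', ''a'', ''b''} \<longrightarrow> regs s'' r = regs s r) \<and>
      t'' + 4 \<le> t + 5 + 250 * Suc i"
  have main: "wp w (Seq (Cond (Eq (Side (Reg ''u'')) (Reg ''g''))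
           (max_into ''a'' (Dist (Reg ''u''))) (max_into ''b'' (Dist (Reg ''u''))))
      (Set_Mem (DistA (Reg ''u'')) size_exp)) ?Q (s'\<lparr>mem := m\<rparr>) t''" if "t'' \<le> t' + 100" for t''
  proof (cases "i \<in> S \<longleftrightarrow> g")
    case True
    then have ev: "eval_exp w (Eq (Side (Reg ''u'')) (Reg ''g'')) (s'\<lparr>mem := m\<rparr>) = 1"
      using I m g by simp
    have "wp w (max_into ''a'' (Dist (Reg ''u'')))
      (wp w (Set_Mem (DistA (Reg ''u'')) size_exp) ?Q) (s'\<lparr>mem := m\<rparr>) (t'' + 7)"
    proof (rule wp_max_into[OF w_pos])
      fix t3 assume t3: "t3 \<le> t'' + 7 + (4 + 2 * exp_cost (Dist (Reg ''u'')))"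
      with that I(6) have "t3 + 30 \<le> t + 5 + 250 * Suc i" by simp
      then show "wp w (Set_Mem (DistA (Reg ''u'')) size_exp) ?Q
        (s'\<lparr>mem := m, regs := (regs (s'\<lparr>mem := m\<rparr>))(''a'' := max (regs (s'\<lparr>mem := m\<rparr>) ''a'')
           (eval_exp w (Dist (Reg ''u'')) (s'\<lparr>mem := m\<rparr>)))\<rparr>) t3"
        using I m True fin nr ds Di by (simp add: half_Suc max.assoc max.commute max.left_commute)
    qed
    with ev show ?thesis by simp
  next
    case False
    then have ev: "eval_exp w (Eq (Side (Reg ''u'')) (Reg ''g'')) (s'\<lparr>mem := m\<rparr>) = 0"
      using I m g by simp
    have "wp w (max_into ''b'' (Dist (Reg ''u'')))
      (wp w (Set_Mem (DistA (Reg ''u'')) size_exp) ?Q) (s'\<lparr>mem := m\<rparr>) (t'' + 7)"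
    proof (rule wp_max_into[OF w_pos])
      fix t3 assume t3: "t3 \<le> t'' + 7 + (4 + 2 * exp_cost (Dist (Reg ''u'')))"
      with that I(6) have "t3 + 30 \<le> t + 5 + 250 * Suc i" by simp
      then show "wp w (Set_Mem (DistA (Reg ''u'')) size_exp) ?Q
        (s'\<lparr>mem := m, regs := (regs (s'\<lparr>mem := m\<rparr>))(''b'' := max (regs (s'\<lparr>mem := m\<rparr>) ''b'')
           (eval_exp w (Dist (Reg ''u'')) (s'\<lparr>mem := m\<rparr>)))\<rparr>) t3"
        using I m False fin nr ds Di by (simp add: half_Suc max.assoc max.commute max.left_commute)
    qed
    with ev show ?thesis by simp
  qed
  \<comment> \<open>Naming the continuation and the postcondition keeps simplification from
    unfolding them while the first conditional is executed.\<close>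
  define rest where "rest = Seq (Cond (Eq (Side (Reg ''u'')) (Reg ''g''))
           (max_into ''a'' (Dist (Reg ''u''))) (max_into ''b'' (Dist (Reg ''u''))))
      (Set_Mem (DistA (Reg ''u'')) size_exp)"
  define Q' where "Q' = ?Q"
  have rest: "wp w rest Q' (s'\<lparr>mem := m\<rparr>) t''" if "t'' \<le> t' + 100" for t''
    using main[OF that] unfolding rest_def Q'_def .
  have "wp w (Seq (Cond (Less (Dist (Reg ''u'')) (Near (Reg ''u'')))
           (Set_Mem (NearA (Reg ''u'')) (Dist (Reg ''u''))) Skip) rest) Q' s' (t' + (3 + exp_cost size_exp))"
    \<comment> \<open>The clock shows \<open>95 + t'\<close> after the write and
      \<open>52 + t'\<close> after \<open>Skip\<close>.\<close>
    using I rest[of "95 + t'"] rest[of "52 + t'"] by (cases "D i < near_arr (mem s) i") (simp_all add: m_def Di)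
  then show ?case
    unfolding rest_def by (rule wp_mono) (simp add: Q'_def incr_def)
next
  case (7 s' t')
  then show ?case by (intro Q) auto
qed (use assms less_word in auto)

text \<open>Dual to \<open>max0\<close>: the base value \<open>n\<close> is the initial array entry
  and stands for infinity over an empty boundary.\<close>

definition min_n :: "('a \<Rightarrow> nat) \<Rightarrow> 'a set \<Rightarrow> nat" where
  "min_n f X = Min (insert n (f ` X))"

lemma min_n_empty [simp]: "min_n f {} = n"
  by (simp add: min_n_def)

lemma min_n_insert [simp]: "finite X \<Longrightarrow> min_n f (insert x X) = min (f x) (min_n f X)"
  by (simp add: min_n_def insert_commute[of n])

abbreviation boundary_below :: "bool \<Rightarrow> nat \<Rightarrow> nat set" where
  "boundary_below g i \<equiv> {b. b < i \<and> on_boundary b \<and> (b \<in> S \<longleftrightarrow> g)}"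

lemma boundary_below_Suc: "boundary_below g (Suc i) = (if on_boundary i \<and> (i \<in> S \<longleftrightarrow> g) then insert i (boundary_below g i) else boundary_below g i)"
  by (auto simp: less_Suc_eq)

abbreviation far :: "bool \<Rightarrow> nat \<Rightarrow> nat" where
  "far g b \<equiv> max0 (capped_hops n R b) (half g n)"

lemma wp_main:
  assumes input: "input (mem s)" and g: "regs s ''g'' = of_bool g"
    and init: "\<forall>u<n. dist_arr (mem s) u = n \<and> near_arr (mem s) u = n" "regs s ''a'' = 0" "regs s ''b'' = 0"
    and Q: "\<And>s' t'. input (mem s') \<Longrightarrow>
      \<forall>u<n. near_arr (mem s') u = min_n (\<lambda>b. capped_hops n R b u) (boundary_below g n) \<Longrightarrow>
      regs s' ''a'' = max0 (far g) (boundary_below g n) \<Longrightarrow> regs s' ''b'' = max0 (far (\<not> g)) (boundary_below g n) \<Longrightarrow>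
      regs s' ''g'' = of_bool g \<Longrightarrow>
      t' \<le> t + 10 + 60 * off n + 200 * n + card (boundary_below g n) * (150 * off n + 450 * n + 300) \<Longrightarrow> Q s' t'"
  shows "wp w main_cmd Q s t"
proof -
  \<comment> \<open>The charge for one boundary vertex: \<open>450 * n\<close> is
    \<open>200 * n\<close> for the search and \<open>250 * n\<close> for the update. The scan of
    every vertex is paid by \<open>60 * off i + 200 * i\<close>.\<close>
  define K where "K = 150 * off n + 450 * n + 300"
  show ?thesis
    unfolding main_cmd_def
  proof (simp add: input, rule wp_for_to[where a = 0 and b = n and I = "\<lambda>i s' t'. input (mem s') \<and>
      (\<forall>u<n. dist_arr (mem s') u = n) \<and>
      (\<forall>u<n. near_arr (mem s') u = min_n (\<lambda>b. capped_hops n R b u) (boundary_below g i)) \<and>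
      regs s' ''a'' = max0 (far g) (boundary_below g i) \<and> regs s' ''b'' = max0 (far (\<not> g)) (boundary_below g i) \<and>
      regs s' ''g'' = of_bool g \<and>
      t' \<le> t + 3 + 60 * off i + 200 * i + card (boundary_below g i) * K"], goal_cases)
    case (6 i s' t')
    then have I: "input (mem s')" "\<forall>u<n. dist_arr (mem s') u = n"
      "\<forall>u<n. near_arr (mem s') u = min_n (\<lambda>b. capped_hops n R b u) (boundary_below g i)"
      "regs s' ''a'' = max0 (far g) (boundary_below g i)" "regs s' ''b'' = max0 (far (\<not> g)) (boundary_below g i)"
      "regs s' ''g'' = of_bool g" "t' \<le> t + 3 + 60 * off i + 200 * i + card (boundary_below g i) * K"
      "regs s' ''v'' = i" "i < n"
      by blast+
    have fin: "finite (boundary_below g i)" and notin: "i \<notin> boundary_below g i" by simp_all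
    show ?case
      unfolding wp_Seq[of w boundary_test_cmd]
    proof (rule wp_boundary_test[where v = i])
      fix t1 assume t1: "t1 \<le> t' + (3 + exp_cost size_exp) + 60 * deg i + 60"
      define s1 where "s1 = s'\<lparr>regs := (regs s')(''f'' := of_bool (on_boundary i), ''j'' := off i + deg i)\<rparr>"
      have s1: "mem s1 = mem s'" "\<And>r. r \<noteq> ''f'' \<Longrightarrow> r \<noteq> ''j'' \<Longrightarrow> regs s1 r = regs s' r"
        "regs s1 ''f'' = of_bool (on_boundary i)"
        by (simp_all add: s1_def)
      have ev: "eval_exp w (Less (Const 1) (Add (Reg ''f'') (Eq (Side (Reg ''v'')) (Reg ''g'')))) s1 =
          of_bool (on_boundary i \<and> (i \<in> S \<longleftrightarrow> g))"
        using I s1 by (cases "on_boundary i"; cases g) simp_all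
      let ?Q = "\<lambda>(s'' :: ram_state) t''. regs s'' ''v'' = i \<and> input (mem s'') \<and>
        (\<forall>u<n. dist_arr (mem s'') u = n) \<and>
        (\<forall>u<n. near_arr (mem s'') u = min_n (\<lambda>b. capped_hops n R b u) (boundary_below g (Suc i))) \<and>
        regs s'' ''a'' = max0 (far g) (boundary_below g (Suc i)) \<and> regs s'' ''b'' = max0 (far (\<not> g)) (boundary_below g (Suc i)) \<and>
        regs s'' ''g'' = of_bool g \<and>
        t'' + 4 \<le> t + 3 + 60 * off (Suc i) + 200 * Suc i + card (boundary_below g (Suc i)) * K"
      have "wp w (Cond (Less (Const 1) (Add (Reg ''f'') (Eq (Side (Reg ''v'')) (Reg ''g''))))
        (Seq bfs_cmd update_cmd) Skip) ?Q s1 t1"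
      proof (cases "on_boundary i \<and> (i \<in> S \<longleftrightarrow> g)")
        case True
        have new: "boundary_below g (Suc i) = insert i (boundary_below g i)" using True by (simp add: boundary_below_Suc)
        have card: "card (boundary_below g (Suc i)) = Suc (card (boundary_below g i))"
          unfolding new using fin notin by simp
        have "wp w bfs_cmd (wp w update_cmd ?Q) s1 (t1 + 11)"
        proof (rule wp_bfs[where v = i])
          fix s2 :: ram_state and t2
          assume B: "input (mem s2)" "near_arr (mem s2) = near_arr (mem s1)"
            "\<forall>u<n. dist_arr (mem s2) u = capped_hops n R i u"
            "\<forall>r. r \<notin> {''h'', ''l'', ''x'', ''j'', ''y''} \<longrightarrow> regs s2 r = regs s1 r"
            "t2 \<le> t1 + 11 + 150 * off n + 200 * n + 200"
          show "wp w update_cmd ?Q s2 t2"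
          proof (rule wp_update[where D = "capped_hops n R i" and g = g])
            fix s3 :: ram_state and t3
            assume U: "input (mem s3)" "\<forall>u<n. dist_arr (mem s3) u = n"
              "\<forall>u<n. near_arr (mem s3) u = min (near_arr (mem s2) u) (capped_hops n R i u)"
              "regs s3 ''a'' = max (regs s2 ''a'') (far g i)"
              "regs s3 ''b'' = max (regs s2 ''b'') (far (\<not> g) i)"
              "\<forall>r. r \<notin> {''u'', ''a'', ''b''} \<longrightarrow> regs s3 r = regs s2 r"
              "t3 \<le> t2 + 250 * n + 10"
            have "t3 + 4 \<le> t + 3 + 60 * off (Suc i) + 200 * Suc i + card (boundary_below g (Suc i)) * K"
              using U(7) B(5) t1 I(7) unfolding card K_def by (simp add: algebra_simps)
            moreover have "\<forall>u<n. near_arr (mem s3) u = min_n (\<lambda>b. capped_hops n R b u) (boundary_below g (Suc i))"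
              unfolding new using U(3) B(2) s1(1) I(3) fin by (simp add: min.commute)
            moreover have "regs s3 ''a'' = max0 (far g) (boundary_below g (Suc i))"
              unfolding new using U(4) B(4) s1(2) I(4) fin by (simp add: max.commute)
            moreover have "regs s3 ''b'' = max0 (far (\<not> g)) (boundary_below g (Suc i))"
              unfolding new using U(5) B(4) s1(2) I(5) fin by (simp add: max.commute)
            moreover have "regs s3 ''v'' = i" "regs s3 ''g'' = of_bool g"
              using U(6) B(4) s1(2) I(6,8) by simp_all
            ultimately show "?Q s3 t3" using U(1,2) by blast
          qed (use B s1 I in simp_all)
        qed (use I s1 in simp_all)
        then show ?thesis unfolding wp_Cond[of w "Less _ _"] ev using True by simp
      next
        case False
        then have old: "boundary_below g (Suc i) = boundary_below g i" by (auto simp: boundary_below_Suc)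
        have "t1 + 16 \<le> t + 3 + 60 * off (Suc i) + 200 * Suc i + card (boundary_below g (Suc i)) * K"
          using t1 I(7) unfolding old by simp
        moreover have "regs s1 ''v'' = i" "regs s1 ''g'' = of_bool g"
            "regs s1 ''a'' = max0 (far g) (boundary_below g (Suc i))"
            "regs s1 ''b'' = max0 (far (\<not> g)) (boundary_below g (Suc i))"
          unfolding old using I s1 by simp_all
        ultimately have "?Q s1 (t1 + 12)" using I(1-3) s1(1) unfolding old by simp
        then show ?thesis unfolding wp_Cond[of w "Less _ _"] ev wp_Skip using False by simp
      qed
      then show "wp w (Cond (Less (Const 1) (Add (Reg ''f'') (Eq (Side (Reg ''v'')) (Reg ''g''))))
        (Seq bfs_cmd update_cmd) Skip)
        (\<lambda>s' t'. regs s' ''v'' = i \<and> input (mem (incr ''v'' s')) \<and>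
        (\<forall>u<n. dist_arr (mem (incr ''v'' s')) u = n) \<and>
        (\<forall>u<n. near_arr (mem (incr ''v'' s')) u = min_n (\<lambda>b. capped_hops n R b u) (boundary_below g (Suc i))) \<and>
        regs (incr ''v'' s') ''a'' = max0 (far g) (boundary_below g (Suc i)) \<and>
        regs (incr ''v'' s') ''b'' = max0 (far (\<not> g)) (boundary_below g (Suc i)) \<and>
        regs (incr ''v'' s') ''g'' = of_bool g \<and>
        t' + 4 \<le> t + 3 + 60 * off (Suc i) + 200 * Suc i + card (boundary_below g (Suc i)) * K)
        (s'\<lparr>regs := (regs s')(''f'' := of_bool (on_boundary i), ''j'' := off i + deg i)\<rparr>) t1"
        unfolding s1_def[symmetric] by (rule wp_mono) (simp add: incr_def)
    qed (use I in auto)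
  next
    case (7 s' t')
    then show ?case by (intro Q) (auto simp: K_def)
  qed (use assms less_word off_eq in auto)
qed

lemma wp_gap:
  assumes input: "input (mem s)" and g: "regs s ''g'' = of_bool g"
    and Q: "\<And>s' t'. mem s' = mem s \<Longrightarrow> regs s' ''p'' = max0 (near_arr (mem s)) (half g n) \<Longrightarrow>
      regs s' ''q'' = max0 (near_arr (mem s)) (half (\<not> g) n) \<Longrightarrow>
      \<forall>r. r \<notin> {''u'', ''p'', ''q''} \<longrightarrow> regs s' r = regs s r \<Longrightarrow> t' \<le> t + 200 * n + 20 \<Longrightarrow> Q s' t'"
  shows "wp w gap_cmd Q s t"
  unfolding gap_cmd_def
proof (simp add: input, rule wp_for_to[where a = 0 and b = n and I = "\<lambda>i s' t'. mem s' = mem s \<and>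
      regs s' ''p'' = max0 (near_arr (mem s)) (half g i) \<and>
      regs s' ''q'' = max0 (near_arr (mem s)) (half (\<not> g) i) \<and>
      (\<forall>r. r \<notin> {''u'', ''p'', ''q''} \<longrightarrow> regs s' r = regs s r) \<and> t' \<le> t + 10 + 200 * i"], goal_cases)
  case (6 i s' t')
  then have I: "mem s' = mem s" "regs s' ''p'' = max0 (near_arr (mem s)) (half g i)"
    "regs s' ''q'' = max0 (near_arr (mem s)) (half (\<not> g) i)"
    "\<forall>r. r \<notin> {''u'', ''p'', ''q''} \<longrightarrow> regs s' r = regs s r" "t' \<le> t + 10 + 200 * i"
    "regs s' ''u'' = i" "i < n"
    by blast+
  have fin: "finite (half g i)" for g by simp
  have ev: "eval_exp w (Near (Reg ''u'')) s' = near_arr (mem s) i"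
    "eval_exp w (Eq (Side (Reg ''u'')) (Reg ''g'')) s' = of_bool (i \<in> S \<longleftrightarrow> g)"
    using I input g by simp_all
  have half: "half h (Suc i) = (if i \<in> S \<longleftrightarrow> h then insert i (half h i) else half h i)" for h
    by (rule half_Suc)
  show ?case
  proof (cases "i \<in> S \<longleftrightarrow> g")
    case True
    show ?thesis
      unfolding wp_Cond[of w "Eq _ _"] ev
      by (simp add: True, rule wp_max_into[OF w_pos], unfold ev)
        (use I fin True in \<open>simp add: incr_def half max.commute\<close>)
  next
    case False
    show ?thesis
      unfolding wp_Cond[of w "Eq _ _"] ev
      by (simp add: False, rule wp_max_into[OF w_pos], unfold ev)
        (use I fin False in \<open>simp add: incr_def half max.commute\<close>)
  qed
next
  case (7 s' t')
  then show ?case by (intro Q) auto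
qed (use assms less_word in auto)

lemma wp_out:
  assumes input: "input (mem s)"
    and le: "regs s ''a'' \<le> n" "regs s ''b'' \<le> n" "regs s ''p'' \<le> n" "regs s ''q'' \<le> n"
    and Q: "\<And>s' t'. (regs s' ''inf'' \<noteq> 0 \<longleftrightarrow> regs s ''a'' = n \<or> regs s ''b'' = n \<or> regs s ''p'' = n) \<Longrightarrow>
      regs s' ''out'' = max (max (regs s ''b'') (regs s ''a'' - 1)) (regs s ''p'' + regs s ''q'') \<Longrightarrow>
      t' \<le> t + 60 \<Longrightarrow> Q s' t'"
  shows "wp w out_cmd Q s t"
proof -
  let ?a = "regs s ''a''" and ?b = "regs s ''b''" and ?p = "regs s ''p''" and ?q = "regs s ''q''"
  have sub: "(2 ^ w + ?a - 1) mod 2 ^ w = ?a - 1" if "?a \<noteq> 0"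
  proof -
    have "2 ^ w + ?a - 1 = 2 ^ w + (?a - 1)" using that by simp
    then show ?thesis using le(1) by simp
  qed
  have le_w: "k \<le> 2 * n \<Longrightarrow> k mod 2 ^ w = k" for k by simp
  let ?inf = "Add (Eq (Reg ''a'') size_exp) (Add (Eq (Reg ''b'') size_exp) (Eq (Reg ''p'') size_exp))"
  define k where "k = eval_exp w ?inf s"
  define s1 where "s1 = s\<lparr>regs := (regs s)(''inf'' := k, ''out'' := ?p + ?q)\<rparr>"
  have k: "k \<noteq> 0 \<longleftrightarrow> ?a = n \<or> ?b = n \<or> ?p = n"
    unfolding k_def using input by (simp split: if_splits)
  have "wp w (max_into ''out'' (Reg ''b''))
    (wp w (Cond (Reg ''a'') (max_into ''out'' (Sub (Reg ''a'') (Const 1))) Skip) Q) s1 (19 + t)"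
  proof (rule wp_max_into[OF w_pos])
    fix t2 assume t2: "t2 \<le> 19 + t + (4 + 2 * exp_cost (Reg ''b''))"
    define s2 where "s2 = s1\<lparr>regs := (regs s1)(''out'' := max (regs s1 ''out'') (eval_exp w (Reg ''b'') s1))\<rparr>"
    have s2: "regs s2 ''a'' = ?a" "regs s2 ''inf'' = k" "regs s2 ''out'' = max (?p + ?q) ?b"
      by (simp_all add: s2_def s1_def)
    have "wp w (Cond (Reg ''a'') (max_into ''out'' (Sub (Reg ''a'') (Const 1))) Skip) Q s2 t2"
    proof (cases "?a = 0")
      case True
      have "Q s2 (Suc (Suc (Suc t2)))" using t2 s2 k True by (intro Q) (auto simp: max.commute)
      with True s2 show ?thesis by simp
    next
      case False
      have "wp w (max_into ''out'' (Sub (Reg ''a'') (Const 1))) Q s2 (Suc (Suc t2))"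
        by (rule wp_max_into[OF w_pos], rule Q)
          (use t2 s2 k False sub in \<open>auto simp: max.commute max.left_commute\<close>)
      with False s2 show ?thesis by simp
    qed
    then show "wp w (Cond (Reg ''a'') (max_into ''out'' (Sub (Reg ''a'') (Const 1))) Skip) Q
      (s1\<lparr>regs := (regs s1)(''out'' := max (regs s1 ''out'') (eval_exp w (Reg ''b'') s1))\<rparr>) t2"
      unfolding s2_def .
  qed
  moreover have "?p + ?q \<le> 2 * n" using le by simp
  ultimately show ?thesis
    unfolding out_cmd_def wp_Seq wp_Set_Reg k_def[symmetric] s1_def by (simp add: le_w)
qed

section \<open>Final values of the registers and the whole program\<close>

lemma max0_ge: "finite X \<Longrightarrow> x \<in> X \<Longrightarrow> f x \<le> max0 f X"
  by (simp add: max0_def)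

lemma max0_le: "finite X \<Longrightarrow> (\<And>x. x \<in> X \<Longrightarrow> f x \<le> k) \<Longrightarrow> max0 f X \<le> k"
  by (auto simp: max0_def)

lemma max0_attained:
  assumes "finite X" "X \<noteq> {}"
  obtains x where "x \<in> X" "max0 f X = f x"
proof -
  have "max0 f X \<in> insert 0 (f ` X)" unfolding max0_def using assms by (intro Max_in) auto
  then show thesis
  proof
    assume "max0 f X = 0"
    with assms max0_ge[OF assms(1), of _ f] that show thesis by (metis all_not_in_conv le_zero_eq)
  qed (use that in auto)
qed

lemma min_n_le: "finite X \<Longrightarrow> x \<in> X \<Longrightarrow> min_n f X \<le> f x" "finite X \<Longrightarrow> min_n f X \<le> n"
  by (simp_all add: min_n_def)

lemma min_n_attained: "finite X \<Longrightarrow> min_n f X \<noteq> n \<Longrightarrow> \<exists>x\<in>X. min_n f X = f x"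
  using Min_in[of "insert n (f ` X)"] by (auto simp: min_n_def)

text \<open>Ties go to \<open>S\<close>, as in \<open>boundary\<close>.\<close>

definition smaller_side :: bool where
  "smaller_side \<longleftrightarrow> card (boundary_below True n) \<le> card (boundary_below False n)"

text \<open>With B = \<open>boundary_below g n\<close>, this is the distance of \<open>u\<close> to
  B. The next four abbreviations are \<open>x\<^sub>A\<close>, \<open>x\<^sub>C\<close>,
  \<open>m\<^sub>A\<close> and \<open>m\<^sub>C\<close> of the overview.\<close>

abbreviation hop_gap :: "bool \<Rightarrow> nat \<Rightarrow> nat" where
  "hop_gap g u \<equiv> min_n (\<lambda>b. capped_hops n R b u) (boundary_below g n)"

abbreviation far_same :: "bool \<Rightarrow> nat" where
  "far_same g \<equiv> max0 (far g) (boundary_below g n)"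

abbreviation far_opposite :: "bool \<Rightarrow> nat" where
  "far_opposite g \<equiv> max0 (far (\<not> g)) (boundary_below g n)"

abbreviation gap_same :: "bool \<Rightarrow> nat" where
  "gap_same g \<equiv> max0 (hop_gap g) (half g n)"

abbreviation gap_opposite :: "bool \<Rightarrow> nat" where
  "gap_opposite g \<equiv> max0 (hop_gap g) (half (\<not> g) n)"

lemma far_le: "b < n \<Longrightarrow> far g b \<le> n"
  using capped_hops_le[OF arcs_subset] by (intro max0_le) auto

lemma wp_program:
  assumes input: "input (mem s)" and zero: "\<And>r. regs s r = 0"
    and few: "\<And>s' t'. off n < n \<Longrightarrow> regs s' ''inf'' \<noteq> 0 \<Longrightarrow> t' \<le> t + 30 \<Longrightarrow> Q s' t'"
    and many: "\<And>s' t' g. n \<le> off n \<Longrightarrow> g = smaller_side \<Longrightarrow>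
      (regs s' ''inf'' \<noteq> 0 \<longleftrightarrow> far_same g = n \<or> far_opposite g = n \<or> gap_same g = n) \<Longrightarrow>
      regs s' ''out'' = max (max (far_opposite g) (far_same g - 1)) (gap_same g + gap_opposite g) \<Longrightarrow>
      t' \<le> t + 200 + 120 * off n + 600 * n + card (boundary_below g n) * (150 * off n + 450 * n + 300) \<Longrightarrow> Q s' t'"
  shows "wp w program Q s t"
proof (cases "off n < n")
  case True
  with few[OF True] input show ?thesis by (simp add: program_def)
next
  case False
  define g where "g = smaller_side"
  define K where "K = card (boundary_below g n) * (150 * off n + 450 * n + 300)"
  have "wp w count_cmd (wp w (Seq (Set_Reg ''g'' (Eq (Const 0) (Less (Reg ''q'') (Reg ''p''))))
      (Seq main_cmd (Seq gap_cmd out_cmd))) Q) s (t + 12)"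
  proof (rule wp_count)
    fix s1 :: ram_state and t1
    assume C: "input (mem s1)" "\<forall>u<n. dist_arr (mem s1) u = n \<and> near_arr (mem s1) u = n"
      "regs s1 ''p'' = card {u. u < n \<and> on_boundary u \<and> u \<in> S}" "regs s1 ''q'' = card {u. u < n \<and> on_boundary u \<and> u \<notin> S}"
      "\<forall>r. r \<notin> {''v'', ''f'', ''j'', ''p'', ''q''} \<longrightarrow> regs s1 r = regs s r"
      "t1 \<le> t + 12 + 60 * off n + 200 * n + 10"
    have g: "eval_exp w (Eq (Const 0) (Less (Reg ''q'') (Reg ''p''))) s1 = of_bool g"
      using C(3,4) by (simp add: g_def smaller_side_def not_less)
    have "wp w main_cmd (wp w (Seq gap_cmd out_cmd) Q)
      (s1\<lparr>regs := (regs s1)(''g'' := of_bool g)\<rparr>) (t1 + 6)"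
    proof (rule wp_main[where g = g])
      fix s2 :: ram_state and t2
      assume M: "input (mem s2)" "\<forall>u<n. near_arr (mem s2) u = hop_gap g u"
        "regs s2 ''a'' = far_same g" "regs s2 ''b'' = far_opposite g" "regs s2 ''g'' = of_bool g"
        "t2 \<le> t1 + 6 + 10 + 60 * off n + 200 * n + card (boundary_below g n) * (150 * off n + 450 * n + 300)"
      have gap: "max0 (near_arr (mem s2)) (half h n) = max0 (hop_gap g) (half h n)" for h
        unfolding max0_def using M(2) by (intro arg_cong[where f = Max] arg_cong[where f = "insert 0"] image_cong) auto
      have "wp w gap_cmd (wp w out_cmd Q) s2 t2"
      proof (rule wp_gap[where g = g])
        fix s3 :: ram_state and t3
        assume F: "mem s3 = mem s2" "regs s3 ''p'' = max0 (near_arr (mem s2)) (half g n)"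
          "regs s3 ''q'' = max0 (near_arr (mem s2)) (half (\<not> g) n)"
          "\<forall>r. r \<notin> {''u'', ''p'', ''q''} \<longrightarrow> regs s3 r = regs s2 r" "t3 \<le> t2 + 200 * n + 20"
        have r: "regs s3 ''a'' = far_same g" "regs s3 ''b'' = far_opposite g"
          "regs s3 ''p'' = gap_same g" "regs s3 ''q'' = gap_opposite g"
          using F M gap by simp_all
        show "wp w out_cmd Q s3 t3"
        proof (rule wp_out, unfold r)
          show "far_same g \<le> n" "far_opposite g \<le> n" by (intro max0_le far_le; simp)+
          show "gap_same g \<le> n" "gap_opposite g \<le> n" by (intro max0_le min_n_le(2); simp)+
        next
          fix s' :: ram_state and t'
          assume "(regs s' ''inf'' \<noteq> 0) = (far_same g = n \<or> far_opposite g = n \<or> gap_same g = n)"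
            "regs s' ''out'' = max (max (far_opposite g) (far_same g - 1)) (gap_same g + gap_opposite g)"
            "t' \<le> t3 + 60"
          then show "Q s' t'"
            using False C(6) M(6) F(5) by (intro many[OF _ g_def]) simp_all
        qed (use F M in simp)
      qed (use M in simp_all)
      then show "wp w (Seq gap_cmd out_cmd) Q s2 t2" by simp
    qed (use C zero in simp_all)
    then show "wp w (Seq (Set_Reg ''g'' (Eq (Const 0) (Less (Reg ''q'') (Reg ''p''))))
      (Seq main_cmd (Seq gap_cmd out_cmd))) Q s1 t1"
      unfolding wp_Seq wp_Set_Reg g by simp
  qed (use input zero in simp_all)
  with False input show ?thesis by (simp add: program_def)
qed

end

section \<open>Correctness of the estimate\<close>

text \<open>\<open>g\<close> in \<open>both_sides\<close> is implicitly universal, so both sides are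
  nonempty and every later fact holds for either choice of the boundary.\<close>

locale bichromatic_graph = encoded_graph +
  assumes sym: "sym R"
    and both_sides: "half g n \<noteq> {}"
begin

lemma finite_boundary_below: "finite (boundary_below g n)"
  by simp

lemma max0_half_attained:
  obtains u where "u \<in> half g n" "max0 f (half g n) = f u"
  by (rule max0_attained[of "half g n" f]) (use both_sides[of g] in auto)

lemma boundary_below_eq: "boundary_below g n = {b \<in> half g n. \<exists>u. u \<notin> half g n \<and> (b, u) \<in> R}"
  using arcs_subset by (auto simp: on_boundary_def)

lemma sym_rtranclD: "(u, v) \<in> R\<^sup>* \<Longrightarrow> (v, u) \<in> R\<^sup>*"
  using sym by (meson sym_rtrancl symD)

text \<open>An empty boundary makes every \<open>hop_gap\<close> equal to \<open>n\<close>.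
  Otherwise a boundary vertex cannot reach both \<open>u\<close> and \<open>v\<close>, and the
  missed vertex contributes \<open>n\<close> to the maximum over its own side.\<close>

lemma disconnected:
  assumes "u < n" "v < n" "(u, v) \<notin> R\<^sup>*"
  shows "far_same g = n \<or> far_opposite g = n \<or> gap_same g = n"
proof (cases "boundary_below g n = {}")
  case True
  obtain s where "s \<in> half g n" using both_sides[of g] by blast
  moreover have "hop_gap g s = n" unfolding True by simp
  ultimately have "n \<le> gap_same g" using max0_ge[of "half g n" s "hop_gap g"] by simp
  moreover have "gap_same g \<le> n" by (intro max0_le min_n_le(2)) auto
  ultimately show ?thesis by simp
next
  case False
  then obtain b where b: "b \<in> boundary_below g n" by blast
  obtain x where x: "x < n" "(b, x) \<notin> R\<^sup>*"
    using assms sym_rtranclD by (meson rtrancl_trans)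
  then have c: "capped_hops n R b x = n" by (simp add: capped_hops_def)
  have h: "max0 (far h) (boundary_below g n) = n" if "x \<in> half h n" for h
  proof (rule antisym)
    show "max0 (far h) (boundary_below g n) \<le> n" by (intro max0_le far_le) auto
    have "n \<le> far h b" using max0_ge[of "half h n" x "capped_hops n R b"] that c by simp
    also have "\<dots> \<le> max0 (far h) (boundary_below g n)" using b by (intro max0_ge) auto
    finally show "n \<le> max0 (far h) (boundary_below g n)" .
  qed
  show ?thesis using h[of g] h[of "\<not> g"] x(1) by auto
qed

context
  assumes connected: "\<And>u v. u < n \<Longrightarrow> v < n \<Longrightarrow> (u, v) \<in> R\<^sup>*"
begin

lemma capped_hops_eq: "u < n \<Longrightarrow> v < n \<Longrightarrow> capped_hops n R u v = hops R u v"
  using connected by (simp add: capped_hops_def)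

lemma hops_less: "u < n \<Longrightarrow> v < n \<Longrightarrow> hops R u v < n"
  using hops_less_card[OF connected arcs_subset] by simp

lemma boundary_crossing:
  assumes "s \<in> half g n" "t \<in> half (\<not> g) n"
  obtains b where "b \<in> boundary_below g n" "hops R b s + hops R b t \<le> hops R s t"
proof -
  have "(s, t) \<in> R\<^sup>*" "t \<notin> half g n" using assms connected by auto
  then obtain b where b: "b \<in> half g n" "\<exists>u. u \<notin> half g n \<and> (b, u) \<in> R"
    "hops R s b + hops R b t \<le> hops R s t"
    using hops_crossing assms(1) by meson
  have "b \<in> boundary_below g n" unfolding boundary_below_eq using b(1,2) by blast
  with b(3) show thesis using that hops_commute[OF sym, of s b] by simp
qed

lemma boundary_below_nonempty: "boundary_below g n \<noteq> {}"
proof -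
  obtain s where s: "s \<in> half g n"
    using both_sides[of g] unfolding ex_in_conv[symmetric] by (rule exE)
  obtain t where t: "t \<in> half (\<not> g) n"
    using both_sides[of "\<not> g"] unfolding ex_in_conv[symmetric] by (rule exE)
  obtain b where "b \<in> boundary_below g n" using boundary_crossing[OF s t] .
  then show ?thesis unfolding ex_in_conv[symmetric] by (rule exI)
qed

lemma hop_gap_less: "u < n \<Longrightarrow> hop_gap g u < n"
proof -
  assume u: "u < n"
  obtain b where b: "b \<in> boundary_below g n" using boundary_below_nonempty[of g] by blast
  have "hop_gap g u \<le> capped_hops n R b u" using b by (intro min_n_le(1)) auto
  also have "\<dots> < n" using b u by (simp add: capped_hops_eq hops_less)
  finally show ?thesis .
qed

lemma hop_gap_attained:
  assumes "u < n"
  obtains b where "b \<in> boundary_below g n" "hop_gap g u = hops R b u"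
proof -
  have "hop_gap g u \<noteq> n" using hop_gap_less[OF assms] by (rule less_imp_neq)
  then obtain b where b: "b \<in> boundary_below g n" "hop_gap g u = capped_hops n R b u"
    using min_n_attained[OF finite_boundary_below] by meson
  then have "capped_hops n R b u = hops R b u" using assms by (intro capped_hops_eq) auto
  with b that show thesis by simp
qed

lemma far_attained:
  obtains b u where "b \<in> boundary_below g n" "u \<in> half h n" "max0 (far h) (boundary_below g n) = hops R b u"
proof -
  obtain b where b: "b \<in> boundary_below g n" "max0 (far h) (boundary_below g n) = far h b"
    by (rule max0_attained[OF finite_boundary_below boundary_below_nonempty])
  obtain u where u: "u \<in> half h n" "far h b = capped_hops n R b u"
    by (rule max0_half_attained)
  from b u that show thesis by (auto simp: capped_hops_eq)
qed

lemma far_ge: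
  assumes "b \<in> boundary_below g n" "u \<in> half h n"
  shows "hops R b u \<le> max0 (far h) (boundary_below g n)"
proof -
  have "hops R b u = capped_hops n R b u" using assms by (simp add: capped_hops_eq)
  also have "\<dots> \<le> far h b" using assms by (intro max0_ge) auto
  also have "\<dots> \<le> max0 (far h) (boundary_below g n)" using assms by (intro max0_ge) auto
  finally show ?thesis .
qed

lemma not_infinite: "far_same g \<noteq> n" "far_opposite g \<noteq> n" "gap_same g \<noteq> n"
proof -
  have "max0 (far h) (boundary_below g n) < n" for h
  proof -
    obtain b u where "b \<in> boundary_below g n" "u \<in> half h n" "max0 (far h) (boundary_below g n) = hops R b u"
      by (rule far_attained)
    then show ?thesis using hops_less by simp
  qed
  then show "far_same g \<noteq> n" "far_opposite g \<noteq> n" by (simp_all add: less_imp_neq)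
  obtain u where "u \<in> half g n" "gap_same g = hop_gap g u"
    by (rule max0_half_attained)
  then show "gap_same g \<noteq> n" using hop_gap_less[of u g] by simp
qed

lemma estimate_lower:
  assumes "s \<in> half g n" "t \<in> half (\<not> g) n"
  shows "2 * hops R s t \<le>
    3 * max (max (far_opposite g) (far_same g - 1)) (gap_same g + gap_opposite g) + 3"
proof -
  have st: "s < n" "t < n" using assms by auto
  obtain b0 where b0: "b0 \<in> boundary_below g n" "hop_gap g s = hops R b0 s" using hop_gap_attained[OF st(1)] .
  obtain b1 where b1: "b1 \<in> boundary_below g n" "hop_gap g t = hops R b1 t" using hop_gap_attained[OF st(2)] .
  show ?thesis
  proof (rule estimate_ge[OF connected[OF st] assms(1) _ boundary_below_eq _ sym _ _ b0(1) _ b1(1)])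
    show "hops R b0 s \<le> gap_same g" unfolding b0(2)[symmetric] using assms(1) by (intro max0_ge) auto
    show "hops R b1 t \<le> gap_opposite g" unfolding b1(2)[symmetric] using assms(2) by (intro max0_ge) auto
    show "hops R b s \<le> far_same g" if "b \<in> boundary_below g n" for b
      using that assms(1) by (rule far_ge)
    show "hops R b t \<le> far_opposite g" if "b \<in> boundary_below g n" for b
      using that assms(2) by (rule far_ge)
    show "(b, u) \<in> R\<^sup>*" if "b \<in> boundary_below g n" "u \<in> {s, t}" for b u
      using that st by (intro connected) auto
  qed (use assms in simp)
qed

text \<open>Each of the three terms gets its own pair of vertices; the maximum equals one of the
  terms.\<close>

lemma estimate_upper:
  obtains s t where "s \<in> half g n" "t \<in> half (\<not> g) n"
    "max (max (far_opposite g) (far_same g - 1)) (gap_same g + gap_opposite g) \<le> hops R s t"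
proof -
  let ?E = "\<lambda>k. \<exists>s\<in>half g n. \<exists>t\<in>half (\<not> g) n. k \<le> hops R s t"
  have "?E (far_opposite g)"
  proof -
    obtain b u where "b \<in> boundary_below g n" "u \<in> half (\<not> g) n" "far_opposite g = hops R b u"
      by (rule far_attained)
    then show ?thesis by (intro bexI[of _ b] bexI[of _ u]) simp_all
  qed
  \<comment> \<open>The farthest \<open>u\<close> lies on the side of \<open>b\<close>, so
    \<open>b\<close> is exchanged for a neighbour \<open>y\<close> across the cut. This exchange
    accounts for the 1.\<close>
  moreover have "?E (far_same g - 1)"
  proof -
    obtain b u where bu: "b \<in> boundary_below g n" "u \<in> half g n" "far_same g = hops R b u"
      by (rule far_attained)
    then obtain y where y: "(b, y) \<in> R" "y \<in> half (\<not> g) n"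
      using arcs_subset by (auto simp: on_boundary_def)
    have "hops R b u \<le> hops R b y + hops R y u"
      using bu y by (intro hops_triangle connected) auto
    then have "far_same g - 1 \<le> hops R u y"
      using hops_arc[OF y(1)] bu(3) hops_commute[OF sym, of u y] by simp
    with bu(2) y(2) show ?thesis by blast
  qed
  \<comment> \<open>One crossing vertex \<open>b\<close> of a shortest walk between the two extremal
    vertices bounds both of their distances to the boundary.\<close>
  moreover have "?E (gap_same g + gap_opposite g)"
  proof -
    obtain s where s: "s \<in> half g n" "gap_same g = hop_gap g s"
      by (rule max0_half_attained)
    obtain t where t: "t \<in> half (\<not> g) n" "gap_opposite g = hop_gap g t"
      by (rule max0_half_attained)
    obtain b where b: "b \<in> boundary_below g n" "hops R b s + hops R b t \<le> hops R s t"
      using boundary_crossing[OF s(1) t(1)] .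
    have "hop_gap g u \<le> hops R b u" if "u < n" for u
      using min_n_le(1)[of "boundary_below g n" b "\<lambda>b. capped_hops n R b u"] b(1) that by (simp add: capped_hops_eq)
    then have "hop_gap g s + hop_gap g t \<le> hops R s t" 
      using s(1) t(1) b(2) by (intro order_trans[OF add_mono b(2)]) simp_all
    then show ?thesis unfolding s(2) t(2) using s(1) t(1) by blast
  qed
  ultimately have "?E (max (max (far_opposite g) (far_same g - 1)) (gap_same g + gap_opposite g))"
    by (simp add: max_def)
  then show thesis using that by blast
qed

end

end

section \<open>From the encoded input to the memory layout\<close>

lemma length_concat_map_upt: "length (concat (map f [0..<n])) = (\<Sum>u<n. length (f u))"
  by (induction n) auto

lemma nth_concat_map_upt:
  "v < n \<Longrightarrow> i < length (f v) \<Longrightarrow> concat (map f [0..<n]) ! ((\<Sum>u<v. length (f u)) + i) = f v ! i"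
proof (induction n)
  case (Suc n)
  show ?case
  proof (cases "v = n")
    case True
    then show ?thesis by (simp add: nth_append length_concat_map_upt)
  next
    case False
    with Suc.prems have "v < n" by simp
    have "(\<Sum>u<v. length (f u)) + i < (\<Sum>u<Suc v. length (f u))" using Suc.prems by simp
    also have "\<dots> \<le> (\<Sum>u<n. length (f u))" using \<open>v < n\<close> by (intro sum_mono2) auto
    finally show ?thesis using Suc.IH[OF \<open>v < n\<close> Suc.prems(2)]
      by (simp add: nth_append length_concat_map_upt)
  qed
qed simp

locale graph_input =
  fixes n :: nat and G :: "nat pair_pre_digraph" and S T :: "nat set" and adj :: "nat \<Rightarrow> nat list" and w :: nat
  assumes graph: "pair_graph G" and verts: "pverts G = {..<n}"
    and sides: "S \<subseteq> pverts G" "T = pverts G - S" "S \<noteq> {}" "T \<noteq> {}"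
    and adj: "adjacency_lists G adj" and word: "8 * length (encode n S adj) \<le> 2 ^ w"
begin

sublocale pair_graph G by (rule graph)

abbreviation "start v \<equiv> \<Sum>u<v. length (adj u)"

lemma set_adj: "v < n \<Longrightarrow> set (adj v) = parcs G `` {v}" "v < n \<Longrightarrow> distinct (adj v)"
  using adj verts by (auto simp: adjacency_lists_def)

lemma arcs_bounded: "parcs G \<subseteq> {..<n} \<times> {..<n}"
  using verts by (auto dest: in_arcsD1 in_arcsD2)

lemma length_encode: "length (encode n S adj) = 2 + 2 * n + start n"
  by (simp add: encode_def length_concat_map_upt)

sublocale bichromatic_graph w n "parcs G" S "\<lambda>v. length (adj v)" "\<lambda>j. concat (map adj [0..<n]) ! j"
  "mem (init_state (encode n S adj))" start
proof
  show "(\<lambda>j. concat (map adj [0..<n]) ! j) ` {start v..<start v + length (adj v)} = parcs G `` {v}"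
    if "v < n" for v
  proof -
    have "{a..<a + l} = (\<lambda>i. a + i) ` {..<l}" for a l :: nat
      using image_add_atLeastLessThan[of a 0 l] by (simp add: lessThan_atLeast0 add.commute)
    note this[of "start v" "length (adj v)"]
    then have "(\<lambda>j. concat (map adj [0..<n]) ! j) ` {start v..<start v + length (adj v)} =
        (\<lambda>j. concat (map adj [0..<n]) ! j) ` (\<lambda>i. start v + i) ` {..<length (adj v)}"
      by simp
    also have "\<dots> = (\<lambda>i. adj v ! i) ` {..<length (adj v)}"
      unfolding image_image by (intro image_cong refl) (simp add: nth_concat_map_upt[OF that])
    also have "\<dots> = set (adj v)" by (auto simp: set_conv_nth)
    finally show ?thesis using set_adj(1)[OF that] by simp
  qed
  have le: "Suc v < length (encode n S adj)" "n + 1 + v < length (encode n S adj)" if "v \<le> n" for v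
    using that by (simp_all add: length_encode)
  show "mem (init_state (encode n S adj)) 0 = n"
    by (simp add: init_state_def encode_def)
  show "mem (init_state (encode n S adj)) (Suc v) = of_bool (v \<in> S)" if "v < n" for v
    using le(1)[of v] that by (simp add: init_state_def) (simp add: encode_def nth_append)
  show "mem (init_state (encode n S adj)) (n + 1 + v) = start v" if "v \<le> n" for v
    using le(2)[of v] that by (simp add: init_state_def) (simp add: encode_def nth_append nth_append_right del: upt_Suc)
  show "mem (init_state (encode n S adj)) (2 + 2 * n + j) = concat (map adj [0..<n]) ! j"
    if "j < start n" for j
    using that by (simp add: init_state_def length_encode) (simp add: encode_def nth_append del: upt_Suc)
  show "8 * (2 + 2 * n + start n) \<le> 2 ^ w" using word by (simp add: length_encode)
  show "sym (parcs G)" using pair_sym_arcs by (simp add: symmetric_def)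
  show "{u. u < n \<and> (u \<in> S \<longleftrightarrow> g)} \<noteq> {}" for g
    using sides verts by (cases g) auto
qed (use arcs_bounded in auto)

text \<open>Arcs are counted by their tails; distinct adjacency lists make each length an
  out-degree.\<close>

lemma start_eq: "start n = card (parcs G)"
proof -
  have "start n = (\<Sum>u<n. card (parcs G `` {u}))"
    by (intro sum.cong refl) (metis distinct_card lessThan_iff set_adj)
  also have "\<dots> = card (SIGMA u:{..<n}. parcs G `` {u})"
    using finite_subset[OF arcs_bounded] by (intro card_SigmaI[symmetric]) (auto intro: finite_Image)
  also have "(SIGMA u:{..<n}. parcs G `` {u}) = parcs G" using arcs_bounded by auto
  finally show ?thesis .
qed

section \<open>Boundary and diameter in terms of the given graph\<close>

lemma half_sides: "half True n = S" "half False n = T"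
  using sides verts by auto

lemma boundary_eq: "boundary G S T = boundary_below smaller_side n"
proof -
  have "having_nbr_in G S T = boundary_below True n" "having_nbr_in G T S = boundary_below False n"
    using sides verts arcs_bounded by (auto simp: having_nbr_in_def on_boundary_def)
  then show ?thesis by (simp add: boundary_def smaller_side_def Let_def)
qed

lemma gdist_commute: "u < n \<Longrightarrow> v < n \<Longrightarrow> gdist G u v = gdist G v u"
  using gdist_eq[of u v] gdist_eq[of v u] verts sym_rtranclD hops_commute[OF sym] by auto

text \<open>Stating both facts for arbitrary \<open>g\<close> hides whether the boundary was taken
  in \<open>S\<close> or in \<open>T\<close>: for \<open>g = False\<close> the roles of
  \<open>s\<close> and \<open>t\<close> are swapped by symmetry of \<open>gdist\<close>.\<close>

lemma diameter_eq:
  shows "\<And>s t. s \<in> half g n \<Longrightarrow> t \<in> half (\<not> g) n \<Longrightarrow> gdist G s t \<le> bichromatic_diameter G S T"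
    and "\<exists>s\<in>half g n. \<exists>t\<in>half (\<not> g) n. bichromatic_diameter G S T = gdist G s t"
proof -
  have fin: "finite S" "finite T" using sides verts finite_subset by auto
  have ge: "gdist G s t \<le> bichromatic_diameter G S T" if "s \<in> S" "t \<in> T" for s t
  proof -
    have "gdist G s t \<le> (MAX t\<in>T. gdist G s t)" using fin that by (intro Max_ge) auto
    also have "\<dots> \<le> bichromatic_diameter G S T"
      unfolding bichromatic_diameter_def using fin that by (intro Max_ge) auto
    finally show ?thesis .
  qed
  have "bichromatic_diameter G S T \<in> (\<lambda>s. MAX t\<in>T. gdist G s t) ` S"
    unfolding bichromatic_diameter_def using fin sides by (intro Max_in) auto
  then obtain s where s: "s \<in> S" "bichromatic_diameter G S T = (MAX t\<in>T. gdist G s t)" by blast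
  have "(MAX t\<in>T. gdist G s t) \<in> gdist G s ` T" using fin sides by (intro Max_in) auto
  with s obtain t where t: "t \<in> T" "bichromatic_diameter G S T = gdist G s t" by auto
  have lt: "u < n" if "u \<in> S \<union> T" for u using that sides verts by auto
  show "gdist G s t \<le> bichromatic_diameter G S T" if st: "s \<in> half g n" "t \<in> half (\<not> g) n" for s t
  proof (cases g)
    case True
    with st half_sides show ?thesis by (intro ge) auto
  next
    case False
    with st half_sides have "t \<in> S" "s \<in> T" by auto
    then show ?thesis using ge[of t s] gdist_commute[of s t] lt by simp
  qed
  show "\<exists>s\<in>half g n. \<exists>t\<in>half (\<not> g) n. bichromatic_diameter G S T = gdist G s t"
  proof (cases g)
    case True
    with half_sides s(1) t show ?thesis by auto
  next
    case False
    with half_sides s(1) t gdist_commute[of s t] lt show ?thesis by auto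
  qed
qed

text \<open>If all pairs across the cut were connected, a fixed \<open>s0\<close> would reach all of
  \<open>T\<close> directly and all of \<open>S\<close> through \<open>t0\<close>.\<close>

lemma diameter_infinite:
  assumes "u < n" "v < n" "(u, v) \<notin> (parcs G)\<^sup>*"
  shows "bichromatic_diameter G S T = \<infinity>"
proof -
  have "\<exists>s\<in>S. \<exists>t\<in>T. (s, t) \<notin> (parcs G)\<^sup>*"
  proof (rule ccontr)
    assume "\<not> ?thesis"
    then have conn: "(s, t) \<in> (parcs G)\<^sup>*" if "s \<in> S" "t \<in> T" for s t using that by blast
    obtain s0 t0 where "s0 \<in> S" "t0 \<in> T" using sides by blast
    then have "(s0, x) \<in> (parcs G)\<^sup>*" if "x < n" for x
      using conn sym_rtranclD sides(2) verts that by (metis Diff_iff lessThan_iff rtrancl_trans)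
    with assms show False using sym_rtranclD by (meson rtrancl_trans)
  qed
  then obtain s t where st: "s \<in> S" "t \<in> T" "(s, t) \<notin> (parcs G)\<^sup>*" by blast
  then have "gdist G s t = \<infinity>" using gdist_eq[of s t] sides by auto
  moreover have "gdist G s t \<le> bichromatic_diameter G S T"
    using st half_sides by (intro diameter_eq(1)[of s True t]) auto
  ultimately show ?thesis by simp
qed

lemma few_arcs:
  assumes "start n < n"
  obtains u v where "u < n" "v < n" "(u, v) \<notin> (parcs G)\<^sup>*"
proof -
  have "\<exists>u<n. adj u = []"
  proof (rule ccontr)
    assume "\<not> ?thesis"
    then have "(\<Sum>u<n. 1) \<le> start n" by (intro sum_mono) (metis One_nat_def Suc_leI \<open>\<not> _\<close> length_greater_0_conv lessThan_iff)
    with assms show False by simp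
  qed
  then obtain u where u: "u < n" "adj u = []" by blast
  obtain s t where st: "s \<in> S" "t \<in> T" using sides by blast
  \<comment> \<open>\<open>s\<close> and \<open>t\<close> lie on different sides, so at least one of
    them differs from the isolated \<open>u\<close>.\<close>
  define v where "v = (if u = s then t else s)"
  have "v < n" "v \<noteq> u" using st sides verts by (auto simp: v_def)
  moreover have "parcs G `` {u} = {}" using set_adj(1)[OF u(1)] u(2) by simp
  then have "(u, v) \<notin> (parcs G)\<^sup>*" using \<open>v \<noteq> u\<close> by (auto elim: converse_rtranclE)
  ultimately show thesis using u(1) that by blast
qed

lemma estimate_bounds:
  assumes inf: "regs s' ''inf'' \<noteq> 0 \<longleftrightarrow> far_same g = n \<or> far_opposite g = n \<or> gap_same g = n"
    and out: "regs s' ''out'' = max (max (far_opposite g) (far_same g - 1)) (gap_same g + gap_opposite g)"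
  shows "2 / 3 * bichromatic_diameter G S T - 1 \<le> estimate s' \<and> estimate s' \<le> bichromatic_diameter G S T"
proof (cases "\<forall>u<n. \<forall>v<n. (u, v) \<in> (parcs G)\<^sup>*")
  case True
  then have conn: "\<And>u v. u < n \<Longrightarrow> v < n \<Longrightarrow> (u, v) \<in> (parcs G)\<^sup>*" by blast
  let ?E = "max (max (far_opposite g) (far_same g - 1)) (gap_same g + gap_opposite g)"
  have gd: "gdist G u v = ereal (hops (parcs G) u v)" if "u < n" "v < n" for u v
    using gdist_eq[of u v] conn that verts by simp
  have est: "estimate s' = ereal (real ?E)"
    using inf out not_infinite[OF conn, of g] by (simp add: estimate_def)
  obtain s t where st: "s \<in> half g n" "t \<in> half (\<not> g) n" "bichromatic_diameter G S T = gdist G s t"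
    using diameter_eq(2) by meson
  then have D: "bichromatic_diameter G S T = ereal (hops (parcs G) s t)" using gd by simp
  have "2 * hops (parcs G) s t \<le> 3 * ?E + 3" by (rule estimate_lower[OF conn st(1,2)])
  moreover have "2 / 3 * real a - 1 \<le> real e" if "2 * a \<le> 3 * e + 3" for a e :: nat
    using that by linarith
  ultimately have "2 / 3 * real (hops (parcs G) s t) - 1 \<le> real ?E" by blast
  then have lower: "2 / 3 * bichromatic_diameter G S T - 1 \<le> estimate s'"
    unfolding D est by (simp add: one_ereal_def numeral_eq_ereal)
  obtain x y where xy: "x \<in> half g n" "y \<in> half (\<not> g) n" "?E \<le> hops (parcs G) x y"
    using estimate_upper[OF conn] .
  then have "gdist G x y = ereal (hops (parcs G) x y)" by (intro gd) auto
  then have "ereal (real ?E) \<le> gdist G x y" using xy(3) by (simp only: ereal_less_eq of_nat_le_iff)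
  also have "\<dots> \<le> bichromatic_diameter G S T" by (rule diameter_eq(1)[OF xy(1,2)])
  finally show ?thesis using lower est by simp
next
  case False
  then obtain u v where uv: "u < n" "v < n" "(u, v) \<notin> (parcs G)\<^sup>*" by blast
  have "estimate s' = \<infinity>" using inf disconnected[OF uv] by (simp add: estimate_def)
  then show ?thesis using diameter_infinite[OF uv] by simp
qed

text \<open>The case split on the boundary is forced: for an empty one the product bound is 0, but
  every run takes positive time.\<close>

lemma program_correct:
  "\<exists>t s'. runs w program (init_state (encode n S adj)) t s' \<and>
    (boundary G S T \<noteq> {} \<longrightarrow> t \<le> 10000 * (card (edges G) * card (boundary G S T))) \<and>
    (boundary G S T = {} \<longrightarrow> t \<le> 10000 * (card (edges G) + 1)) \<and>
    2 / 3 * bichromatic_diameter G S T - 1 \<le> estimate s' \<and>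
    estimate s' \<le> bichromatic_diameter G S T"
proof -
  let ?m = "card (edges G)" and ?B = "boundary G S T"
  have start: "start n \<le> 2 * ?m" using card_parcs_le start_eq by simp
  have finB: "finite ?B" unfolding boundary_eq by (rule finite_boundary_below)
  have m: "1 \<le> ?m" if "?B \<noteq> {}"
  proof -
    from that obtain b u where "(b, u) \<in> parcs G" unfolding boundary_eq on_boundary_def by blast
    then have "0 < card (parcs G)" using pair_finite_arcs by (auto simp: card_gt_0_iff)
    with card_parcs_le show ?thesis by linarith
  qed
  have B: "1 \<le> card ?B" if "?B \<noteq> {}" using that finB by (metis One_nat_def Suc_leI card_gt_0_iff)
  have "wp w program (\<lambda>s' t.
    (?B \<noteq> {} \<longrightarrow> t \<le> 10000 * (?m * card ?B)) \<and> (?B = {} \<longrightarrow> t \<le> 10000 * (?m + 1)) \<and>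
    2 / 3 * bichromatic_diameter G S T - 1 \<le> estimate s' \<and>
    estimate s' \<le> bichromatic_diameter G S T) (init_state (encode n S adj)) 0"
  proof (rule wp_program)
    show "input (mem (init_state (encode n S adj)))" by (simp add: input_def)
    show "regs (init_state (encode n S adj)) r = 0" for r by (simp add: init_state_def)
  next
    fix s' :: ram_state and t :: nat
    assume few: "start n < n" and s': "regs s' ''inf'' \<noteq> 0" "t \<le> 0 + 30"
    obtain u v where uv: "u < n" "v < n" "(u, v) \<notin> (parcs G)\<^sup>*" using few_arcs[OF few] .
    have "1 \<le> ?m * card ?B" if "?B \<noteq> {}" using mult_le_mono[OF m[OF that] B[OF that]] by simp
    then have "?B \<noteq> {} \<longrightarrow> t \<le> 10000 * (?m * card ?B)" using s'(2) by fastforce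
    moreover have "?B = {} \<longrightarrow> t \<le> 10000 * (?m + 1)" using s'(2) by simp
    ultimately show "(?B \<noteq> {} \<longrightarrow> t \<le> 10000 * (?m * card ?B)) \<and> (?B = {} \<longrightarrow> t \<le> 10000 * (?m + 1)) \<and>
      2 / 3 * bichromatic_diameter G S T - 1 \<le> estimate s' \<and>
      estimate s' \<le> bichromatic_diameter G S T"
      using s'(1) diameter_infinite[OF uv] by (simp add: estimate_def)
  next
    fix s' :: ram_state and t :: nat and g
    assume many: "n \<le> start n" and g: "g = smaller_side"
      and inf: "regs s' ''inf'' \<noteq> 0 \<longleftrightarrow> far_same g = n \<or> far_opposite g = n \<or> gap_same g = n"
      and out: "regs s' ''out'' = max (max (far_opposite g) (far_same g - 1)) (gap_same g + gap_opposite g)"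
      and t: "t \<le> 0 + 200 + 120 * start n + 600 * n + card (boundary_below g n) * (150 * start n + 450 * n + 300)"
    have "0 < n" using sides verts by auto
    then have m1: "1 \<le> ?m" using many start by linarith
    \<comment> \<open>With \<open>start n\<close> and \<open>n\<close> at most \<open>2 * ?m\<close>
      and \<open>1 \<le> ?m\<close>, the coefficients are 300 + 900 + 300 here and 200 + 240 + 1200
      in the next bound. A nonempty boundary then absorbs \<open>?m\<close> into
      \<open>?m * card ?B\<close>.\<close>
    have "card ?B * (150 * start n + 450 * n + 300) \<le> card ?B * (1500 * ?m)"
      using many start m1 by (intro mult_le_mono2) linarith
    moreover have "200 + 120 * start n + 600 * n \<le> 1640 * ?m" using many start m1 by linarith
    moreover have "card ?B * (1500 * ?m) = 1500 * (?m * card ?B)" by simp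
    ultimately have t': "t \<le> 1640 * ?m + 1500 * (?m * card ?B)"
      using t[folded g boundary_eq[folded g]] by linarith
    have "?m \<le> ?m * card ?B" if "?B \<noteq> {}" using mult_le_mono2[OF B[OF that], of ?m] by simp
    then have "?B \<noteq> {} \<longrightarrow> t \<le> 10000 * (?m * card ?B)" using t' by fastforce
    moreover have "?B = {} \<longrightarrow> t \<le> 10000 * (?m + 1)" using t' by auto
    ultimately show "(?B \<noteq> {} \<longrightarrow> t \<le> 10000 * (?m * card ?B)) \<and> (?B = {} \<longrightarrow> t \<le> 10000 * (?m + 1)) \<and>
      2 / 3 * bichromatic_diameter G S T - 1 \<le> estimate s' \<and>
      estimate s' \<le> bichromatic_diameter G S T"
      using estimate_bounds[OF inf out] by blast
  qed
  then show ?thesis unfolding wp_def by simp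
qed

end

theorem theorem29:
  shows "\<exists>(P::cmd) (c::nat) (k::nat).
    \<forall>(n::nat) (G::nat pair_pre_digraph) (S::nat set) (T::nat set) (adj::nat \<Rightarrow> nat list) (w::nat).
      pair_graph G \<and> pverts G = {..<n} \<and>
      S \<subseteq> pverts G \<and> T = pverts G - S \<and> S \<noteq> {} \<and> T \<noteq> {} \<and>
      adjacency_lists G adj \<and> k * length (encode n S adj) \<le> 2 ^ w \<longrightarrow>
      (\<exists>t s'. runs w P (init_state (encode n S adj)) t s' \<and>
        (boundary G S T \<noteq> {} \<longrightarrow> t \<le> c * (card (edges G) * card (boundary G S T))) \<and>
        (boundary G S T = {} \<longrightarrow> t \<le> c * (card (edges G) + 1)) \<and>
        2 / 3 * bichromatic_diameter G S T - 1 \<le> estimate s' \<and>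
        estimate s' \<le> bichromatic_diameter G S T)"
proof (rule exI[of _ program], rule exI[of _ 10000], rule exI[of _ 8], intro allI impI)
  fix n G S T adj w
  assume "pair_graph G \<and> pverts G = {..<n} \<and> S \<subseteq> pverts G \<and> T = pverts G - S \<and> S \<noteq> {} \<and> T \<noteq> {} \<and>
    adjacency_lists G adj \<and> 8 * length (encode n S adj) \<le> 2 ^ w"
  then interpret graph_input n G S T adj w
    by (intro graph_input.intro) blast+
  show "\<exists>t s'. runs w program (init_state (encode n S adj)) t s' \<and>
    (boundary G S T \<noteq> {} \<longrightarrow> t \<le> 10000 * (card (edges G) * card (boundary G S T))) \<and>
    (boundary G S T = {} \<longrightarrow> t \<le> 10000 * (card (edges G) + 1)) \<and>
    2 / 3 * bichromatic_diameter G S T - 1 \<le> estimate s' \<and>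
    estimate s' \<le> bichromatic_diameter G S T"
    by (rule program_correct)
qed

end
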